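(* Let $k$ be a field of characteristic $0$, let $\mathcal A$ be a commutative $k$-algebra (typically $C^\infty(M)$ for a smooth manifold $M$), and let $\Xi$ and $\Phi$ be $\mathcal A$-modules. Let $\delta:\Xi\to\mathrm{Hom}(\Lambda^*\Phi,\Phi)$ be a $k$-linear map, with extension $\hat\delta:\mathrm{Hom}_k(\Lambda^*\Phi,\Xi)\to\mathrm{Hom}(\Lambda^*\Phi,\Phi)$. Suppose that the BBvD (Berends–Burgers–van Dam) hypothesis holds, i.e. there is a map $C:\Xi\otimes\Xi\to\mathrm{Hom}_k(\Lambda^*\Phi,\Xi)$ such that $$[\delta(\xi),\delta(\eta)]=\hat\delta\, C(\xi,\eta)\in\mathrm{Hom}(\Lambda^*\Phi,\Phi)\qquad\text{for all }\xi,\eta\in\Xi,$$ and suppose that $\hat\delta$ is injective (so that the bracket $[\pi_1,\pi_2]:=\pi_1\odot\hat\delta(\pi_2)-\pi_2\odot\hat\delta(\pi_1)+\hat C(\pi_1,\pi_2)$ on $\mathrm{Hom}_k(\Lambda^*\Phi,\Xi)$ satisfies the Jacobi identity). Let $\mathbb L$ be the differential graded vector space with $\Xi$ in degree $0$, $\Phi$ in degree $1$ and $0$ in all other degrees, with differential $\partial:\Xi\to\Phi$ given by $\partial(\xi)=\delta(\xi)(1)\in\Phi$. Then the linear map $D:\Lambda^*(\downarrow\mathbb L)\to\ \downarrow\mathbb L$ given by $$D(\xi)=\partial(\xi),$$ $$D(\xi\wedge\phi_1\wedge\cdots\wedge\phi_n)=\delta(\xi)(\phi_1\wedge\cdots\wedge\phi_n)\quad\text{for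 } n\ge 1,$$ $$D(\xi_1\wedge\xi_2\wedge\phi_1\wedge\cdots\wedge\phi_n)=C(\xi_1,\xi_2)(\phi_1\wedge\cdots\wedge\phi_n),$$ and $D=0$ on elements of $\Lambda^*(\downarrow\mathbb L)$ with more than two entries from $\Xi$ or with no entry from $\Xi$, gives $\mathbb L$ the structure of an sh-Lie algebra.
   Context: $\mathrm{Hom}$ denotes $\mathcal A$-linear maps and $\mathrm{Hom}_k$ denotes $k$-linear maps. The map $\delta$ is only assumed $k$-linear; $C$ is likewise understood to be $k$-linear, and $\mathbb L$ is regarded as a graded vector space over $k$. In the formulas for $D$, $\xi,\xi_1,\xi_2\in\Xi$, $\phi_i\in\Phi$, and an empty wedge of $\phi$'s is $1$. $\Lambda^*\Phi$ is the free nilpotent graded cocommutative coalgebra over $\mathcal A$ cogenerated by $\Phi$ (the coalgebra of graded symmetric tensors in the full tensor coalgebra on $\Phi$), with comultiplication $\Delta$, given on $\phi_1\wedge\cdots\wedge\phi_n$ by the sum of $(\phi_{\sigma(1)}\wedge\cdots\wedge\phi_{\sigma(p)})\otimes(\phi_{\sigma(p+1)}\wedge\cdots\wedge\phi_{\sigma(n)})$ over $0\le p\le n$ and all $(p,n-p)$-unshuffles $\sigma$, i.e. permutations of $\{1,\dots,n\}$ with $\sigma(1)<\cdots<\sigma(p)$ and $\sigma(p+1)<\cdots<\sigma(n)$. Let $m$ be the usual (wedge) product in $\Lambda^*\Phi$ regarded as an algebra. For $h\in\mathrm{Hom}(\Lambda^*\Phi,\Phi)$, let $\overline h:=m\circ(h\otimes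 1)\circ\Delta$ be the corresponding coderivation of $\Lambda^*\Phi$. For $g\in\mathrm{Hom}(\Lambda^*\Phi,\Phi)$ and $f$ in $\mathrm{Hom}(\Lambda^*\Phi,\Phi)$ or $\mathrm{Hom}_k(\Lambda^*\Phi,\Xi)$, put $f\odot g:=f\circ\overline g$. The bracket on $\mathrm{Hom}(\Lambda^*\Phi,\Phi)$ is the Gerstenhaber bracket $[f,g]=f\odot g-g\odot f$. The extension $\hat\delta$ is $\hat\delta(\pi)=ev\circ(\delta\circ\pi\otimes 1)\circ\Delta$, where $ev$ is the evaluation map; that is, $$\hat\delta(\pi)(\phi_1\wedge\cdots\wedge\phi_n)=\sum_{\sigma}\delta\big(\pi(\phi_{\sigma(1)}\wedge\cdots\wedge\phi_{\sigma(p)})\big)(\phi_{\sigma(p+1)}\wedge\cdots\wedge\phi_{\sigma(n)}),$$ the sum being over all $p$ and all $(p,n-p)$-unshuffles $\sigma$. The extension $\hat C$ of $C$ is $\hat C(\pi_1,\pi_2)=C\circ((\pi_1\otimes\pi_2)\otimes 1)\circ(\Delta\otimes 1)\circ\Delta$, where $C$ is identified with its adjoint $\Xi\otimes\Xi\otimes\Lambda^*\Phi\to\Xi$, $(\xi,\eta,F)\mapsto C(\xi,\eta)(F)$. The desuspension $\downarrow\mathbb L$ is given by $(\downarrow\mathbb L)_n=\mathbb L_{n+1}$; here it has $\Xi$ in degree $-1$ and $\Phi$ in degree $0$. $\Lambda^*(\downarrow\mathbb L)$ is the graded symmetric coalgebra on $\downarrow\mathbb L$, with the usual Koszul sign conventions.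 A linear map $D:\Lambda^*(\downarrow\mathbb L)\to\ \downarrow\mathbb L$ determines a coderivation $$\overline D(x_1\wedge\cdots\wedge x_n)=\sum_{\sigma}e(\sigma)\,D(x_{\sigma(1)}\wedge\cdots\wedge x_{\sigma(p)})\wedge x_{\sigma(p+1)}\wedge\cdots\wedge x_{\sigma(n)}$$ (sum over all $p$ and all $(p,n-p)$-unshuffles $\sigma$, with $e(\sigma)$ the Koszul sign). An sh-Lie ($L_\infty$) algebra structure on a cochain complex $(\mathbb L,d)$ (with $d$ of degree $+1$) is a coderivation $\overline D$ of degree $+1$ on $\Lambda^*(\downarrow\mathbb L)$ with $\overline D^2=0$ (its linear part being the differential $d$); equivalently, a linear map $D:\Lambda^*(\downarrow\mathbb L)\to\ \downarrow\mathbb L$ with $D\circ\overline D=0$.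
   Formalization: Hom_k(Λ*Φ,Ξ) is read as k-linear maps on the symmetric coalgebra of Φ formed over k (not over 𝒜), and δ̂ is taken injective on these, since for merely k-linear π the formula for δ̂(π) need not define an 𝒜-linear map on Λ*Φ. *)

theory Defs
  imports Complex_Main "HOL-Library.Poly_Mapping" "HOL-Library.Product_Plus"
    "HOL-Combinatorics.Permutations"
begin

section \<open>Algebras over a field\<close>

locale comm_algebra = vector_space sA
  for sA :: "'k::field \<Rightarrow> 'a::comm_ring_1 \<Rightarrow> 'a" +
  assumes scale_mult_left: "sA c (x * y) = sA c x * y"

definition restrict_scalars ::
    "('k \<Rightarrow> 'a::comm_ring_1 \<Rightarrow> 'a) \<Rightarrow> ('a \<Rightarrow> 'm \<Rightarrow> 'm) \<Rightarrow> 'k \<Rightarrow> 'm \<Rightarrow> 'm" where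
  "restrict_scalars sA sM c x = sM (sA c 1) x"


section \<open>The graded symmetric coalgebra\<close>

text \<open>
  Let \<open>V\<close> be a graded module over a commutative ring, given by its scalar multiplication \<open>s\<close>
  and its homogeneous components \<open>V n\<close>. The module \<open>\<Lambda>\<^sup>*V\<close> is the quotient of the free module on
  all words \<open>x\<^sub>1 \<dots> x\<^sub>n\<close> in elements of \<open>V\<close> by the submodule \<open>sym_null s V\<close> generated by
  multilinearity and by graded symmetry (with Koszul sign). In characteristic \<open>0\<close> this is isomorphic,
  by symmetrization, to the graded symmetric tensors in the tensor coalgebra; the class of the
  word \<open>x\<^sub>1 \<dots> x\<^sub>n\<close> is \<open>x\<^sub>1 \<and> \<dots> \<and> x\<^sub>n\<close>.

  Elements of \<open>\<Lambda>\<^sup>*V\<close> are handled through representatives in the free module: two of them are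
  equal if their difference lies in \<open>sym_null s V\<close>, and a linear map on \<open>\<Lambda>\<^sup>*V\<close> is a linear map on
  the free module that respects \<open>sym_null s V\<close>.
\<close>

definition wscale :: "'r::comm_ring_1 \<Rightarrow> ('b \<Rightarrow>\<^sub>0 'r) \<Rightarrow> ('b \<Rightarrow>\<^sub>0 'r)" where
  "wscale c = Poly_Mapping.map (\<lambda>a. c * a)"

lemma lookup_wscale [simp]:
  "Poly_Mapping.lookup (wscale c p) b = c * Poly_Mapping.lookup p b"
  by (simp add: wscale_def Poly_Mapping.map.rep_eq when_def)

lemma module_wscale: "module wscale"
  by unfold_locales (auto intro!: poly_mapping_eqI simp: lookup_add algebra_simps)

definition wedge :: "'v list \<Rightarrow> ('v list \<Rightarrow>\<^sub>0 'r::comm_ring_1)" where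
  "wedge xs = Poly_Mapping.single xs 1"

text \<open>The linear map on the free module with prescribed values on words.\<close>

definition extend ::
    "('r::comm_ring_1 \<Rightarrow> 'w::ab_group_add \<Rightarrow> 'w) \<Rightarrow> ('v list \<Rightarrow> 'w) \<Rightarrow> ('v list \<Rightarrow>\<^sub>0 'r) \<Rightarrow> 'w" where
  "extend t f p = (\<Sum>xs\<in>Poly_Mapping.keys p. t (Poly_Mapping.lookup p xs) (f xs))"

definition sym_relations ::
    "('r::comm_ring_1 \<Rightarrow> 'v::ab_group_add \<Rightarrow> 'v) \<Rightarrow> (int \<Rightarrow> 'v set) \<Rightarrow> ('v list \<Rightarrow>\<^sub>0 'r) set" where
  "sym_relations s V =
     {wedge (us @ (x + y) # vs) - wedge (us @ x # vs) - wedge (us @ y # vs) | us x y vs. True}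
   \<union> {wedge (us @ s c x # vs) - wscale c (wedge (us @ x # vs)) | us c x vs. True}
   \<union> {wedge (us @ x # y # vs) - wscale (if odd i \<and> odd j then - 1 else 1) (wedge (us @ y # x # vs))
        | us x y vs i j. x \<in> V i \<and> y \<in> V j}"

definition sym_null ::
    "('r::comm_ring_1 \<Rightarrow> 'v::ab_group_add \<Rightarrow> 'v) \<Rightarrow> (int \<Rightarrow> 'v set) \<Rightarrow> ('v list \<Rightarrow>\<^sub>0 'r) set" where
  "sym_null s V = module.span wscale (sym_relations s V)"

text \<open>Linear maps from \<open>\<Lambda>\<^sup>*V\<close> to a module with scalar multiplication \<open>t\<close>.\<close>

definition sym_hom ::
    "('r::comm_ring_1 \<Rightarrow> 'v::ab_group_add \<Rightarrow> 'v) \<Rightarrow> (int \<Rightarrow> 'v set)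
      \<Rightarrow> ('r \<Rightarrow> 'w::ab_group_add \<Rightarrow> 'w) \<Rightarrow> (('v list \<Rightarrow>\<^sub>0 'r) \<Rightarrow> 'w) set" where
  "sym_hom s V t = {F. module_hom wscale t F \<and> (\<forall>w \<in> sym_null s V. F w = 0)}"

definition unshuffles :: "nat \<Rightarrow> nat \<Rightarrow> (nat \<Rightarrow> nat) set" where
  "unshuffles p n =
     {\<sigma>. \<sigma> permutes {..<n} \<and> strict_mono_on {..<p} \<sigma> \<and> strict_mono_on {p..<n} \<sigma>}"

text \<open>The Koszul sign \<open>e(\<sigma>)\<close> for homogeneous elements of degrees \<open>ds\<close>: each inversion of \<open>\<sigma>\<close>
  between two odd elements contributes \<open>-1\<close>.\<close>

definition koszul_sign :: "int list \<Rightarrow> (nat \<Rightarrow> nat) \<Rightarrow> 'r::comm_ring_1" where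
  "koszul_sign ds \<sigma> =
     (\<Prod>(i, j) \<in> {(i, j). i < j \<and> j < length ds \<and> \<sigma> j < \<sigma> i}.
        if odd (ds ! \<sigma> i) \<and> odd (ds ! \<sigma> j) then - 1 else 1)"

text \<open>
  The value of the coderivation determined by \<open>h\<close> on \<open>x\<^sub>1 \<and> \<dots> \<and> x\<^sub>n\<close>, with \<open>x\<^sub>i\<close> homogeneous of
  degree \<open>ds ! (i - 1)\<close>. Note that \<open>permute_list \<sigma> xs\<close> is \<open>x\<^bsub>\<sigma>(1)\<^esub>, \<dots>, x\<^bsub>\<sigma>(n)\<^esub>\<close>.
\<close>

definition coder_word ::
    "(('v list \<Rightarrow>\<^sub>0 'r::comm_ring_1) \<Rightarrow> 'v) \<Rightarrow> int list \<Rightarrow> 'v list \<Rightarrow> ('v list \<Rightarrow>\<^sub>0 'r)" where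
  "coder_word h ds xs =
     (\<Sum>p\<le>length xs. \<Sum>\<sigma>\<in>unshuffles p (length xs).
        wscale (koszul_sign ds \<sigma>)
          (wedge (h (wedge (take p (permute_list \<sigma> xs))) # drop p (permute_list \<sigma> xs))))"


section \<open>Modules in degree zero\<close>

definition deg0 :: "int \<Rightarrow> 'v::zero set" where
  "deg0 n = (if n = 0 then UNIV else {0})"

text \<open>The coderivation \<open>m \<circ> (h \<otimes> 1) \<circ> \<Delta>\<close> of \<open>\<Lambda>\<^sup>*\<Phi>\<close>, where \<open>\<Phi>\<close> is in degree \<open>0\<close>.\<close>

definition coder :: "(('p list \<Rightarrow>\<^sub>0 'r::comm_ring_1) \<Rightarrow> 'p) \<Rightarrow> ('p list \<Rightarrow>\<^sub>0 'r) \<Rightarrow> ('p list \<Rightarrow>\<^sub>0 'r)" where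
  "coder h = extend wscale (\<lambda>xs. coder_word h (replicate (length xs) 0) xs)"

definition odot ::
    "(('p list \<Rightarrow>\<^sub>0 'r::comm_ring_1) \<Rightarrow> 'w) \<Rightarrow> (('p list \<Rightarrow>\<^sub>0 'r) \<Rightarrow> 'p) \<Rightarrow> ('p list \<Rightarrow>\<^sub>0 'r) \<Rightarrow> 'w" where
  "odot f g = f \<circ> coder g"

definition gbracket ::
    "(('p list \<Rightarrow>\<^sub>0 'r::comm_ring_1) \<Rightarrow> 'p::ab_group_add) \<Rightarrow> (('p list \<Rightarrow>\<^sub>0 'r) \<Rightarrow> 'p)
      \<Rightarrow> ('p list \<Rightarrow>\<^sub>0 'r) \<Rightarrow> 'p" where
  "gbracket f g = (\<lambda>w. odot f g w - odot g f w)"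

text \<open>
  The extension of \<open>\<delta>\<close>. Here \<open>\<pi>\<close> is only linear over the ground field \<open>k\<close>, so that \<open>\<delta> \<circ> \<pi> \<otimes> 1\<close>
  does not descend to tensor products over the algebra \<open>A\<close>. Accordingly \<open>\<pi>\<close> is a \<open>k\<close>-linear map on
  the symmetric coalgebra of \<open>\<Phi>\<close> formed over \<open>k\<close> (a family of symmetric \<open>k\<close>-multilinear
  functions of elements of \<open>\<Phi>\<close>), whereas \<open>\<delta> \<xi>\<close> is an \<open>A\<close>-linear map on the one formed over \<open>A\<close>.
  The result is extended \<open>A\<close>-linearly from words; an equation \<open>h = hat_delta sP \<delta> \<pi>\<close> with
  \<open>h \<in> sym_hom sP deg0 sP\<close> thus includes that the right-hand side descends to the quotient.
\<close>

definition hat_delta ::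
    "('a::comm_ring_1 \<Rightarrow> 'p::ab_group_add \<Rightarrow> 'p) \<Rightarrow> ('x \<Rightarrow> ('p list \<Rightarrow>\<^sub>0 'a) \<Rightarrow> 'p)
      \<Rightarrow> (('p list \<Rightarrow>\<^sub>0 'k::comm_ring_1) \<Rightarrow> 'x) \<Rightarrow> ('p list \<Rightarrow>\<^sub>0 'a) \<Rightarrow> 'p" where
  "hat_delta sP \<delta> \<pi> = extend sP (\<lambda>xs.
     \<Sum>p\<le>length xs. \<Sum>\<sigma>\<in>unshuffles p (length xs).
       \<delta> (\<pi> (wedge (take p (permute_list \<sigma> xs)))) (wedge (drop p (permute_list \<sigma> xs))))"


section \<open>Strongly homotopy Lie algebras\<close>

definition graded_space ::
    "('k::field \<Rightarrow> 'v::ab_group_add \<Rightarrow> 'v) \<Rightarrow> (int \<Rightarrow> 'v set) \<Rightarrow> bool" where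
  "graded_space s V \<longleftrightarrow> vector_space s \<and> (\<forall>n. module.subspace s (V n)) \<and>
     (\<forall>x. \<exists>!c. (\<forall>n. c n \<in> V n) \<and> finite {n. c n \<noteq> 0} \<and> x = (\<Sum>n | c n \<noteq> 0. c n))"

definition cochain_complex ::
    "('k::field \<Rightarrow> 'v::ab_group_add \<Rightarrow> 'v) \<Rightarrow> (int \<Rightarrow> 'v set) \<Rightarrow> ('v \<Rightarrow> 'v) \<Rightarrow> bool" where
  "cochain_complex s V d \<longleftrightarrow> graded_space s V \<and> Vector_Spaces.linear s s d \<and>
     (\<forall>n. d ` V n \<subseteq> V (n + 1)) \<and> (\<forall>x. d (d x) = 0)"

definition desuspension :: "(int \<Rightarrow> 'v set) \<Rightarrow> int \<Rightarrow> 'v set" where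
  "desuspension V n = V (n + 1)"

definition homogeneous_list :: "(int \<Rightarrow> 'v set) \<Rightarrow> 'v list \<Rightarrow> int list \<Rightarrow> bool" where
  "homogeneous_list V xs ds \<longleftrightarrow> list_all2 (\<lambda>x d. x \<in> V d) xs ds"

definition has_degree :: "(int \<Rightarrow> 'v set) \<Rightarrow> int \<Rightarrow> (('v list \<Rightarrow>\<^sub>0 'r::comm_ring_1) \<Rightarrow> 'v) \<Rightarrow> bool" where
  "has_degree V e D \<longleftrightarrow>
     (\<forall>xs ds. homogeneous_list V xs ds \<longrightarrow> D (wedge xs) \<in> V (sum_list ds + e))"

text \<open>\<open>E\<close> represents the coderivation of \<open>\<Lambda>\<^sup>*V\<close> determined by \<open>D\<close>.\<close>

definition is_coderivation_of ::
    "('k::field \<Rightarrow> 'v::ab_group_add \<Rightarrow> 'v) \<Rightarrow> (int \<Rightarrow> 'v set)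
      \<Rightarrow> (('v list \<Rightarrow>\<^sub>0 'k) \<Rightarrow> 'v) \<Rightarrow> (('v list \<Rightarrow>\<^sub>0 'k) \<Rightarrow> ('v list \<Rightarrow>\<^sub>0 'k)) \<Rightarrow> bool" where
  "is_coderivation_of s V D E \<longleftrightarrow>
     module_hom wscale wscale E \<and> (\<forall>w \<in> sym_null s V. E w \<in> sym_null s V) \<and>
     (\<forall>xs ds. homogeneous_list V xs ds \<longrightarrow> E (wedge xs) - coder_word D ds xs \<in> sym_null s V)"

text \<open>
  \<open>D\<close> is an sh-Lie structure on the cochain complex \<open>(L, d)\<close>: its coderivation on \<open>\<Lambda>\<^sup>*(\<down>L)\<close> has
  degree \<open>+1\<close> (equivalently, \<open>D\<close> has), square zero, linear part \<open>d\<close>, and no constant term.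
\<close>

definition sh_Lie_structure ::
    "('k::field \<Rightarrow> 'v::ab_group_add \<Rightarrow> 'v) \<Rightarrow> (int \<Rightarrow> 'v set) \<Rightarrow> ('v \<Rightarrow> 'v)
      \<Rightarrow> (('v list \<Rightarrow>\<^sub>0 'k) \<Rightarrow> 'v) \<Rightarrow> bool" where
  "sh_Lie_structure s L d D \<longleftrightarrow>
     cochain_complex s L d \<and>
     D \<in> sym_hom s (desuspension L) s \<and>
     has_degree (desuspension L) 1 D \<and>
     D (wedge []) = 0 \<and> (\<forall>x. D (wedge [x]) = d x) \<and>
     (\<exists>E. is_coderivation_of s (desuspension L) D E \<and>
          (\<forall>w. E (E w) \<in> sym_null s (desuspension L)))"


section \<open>The gauge complex\<close>

text \<open>\<open>L = \<Xi> \<oplus> \<Phi>\<close> with \<open>\<Xi>\<close> in degree \<open>0\<close> and \<open>\<Phi>\<close> in degree \<open>1\<close>.\<close>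

definition gauge_grading :: "int \<Rightarrow> ('x::zero \<times> 'p::zero) set" where
  "gauge_grading n = (if n = 0 then UNIV \<times> {0} else if n = 1 then {0} \<times> UNIV else {(0, 0)})"

definition gauge_scale :: "('k \<Rightarrow> 'x \<Rightarrow> 'x) \<Rightarrow> ('k \<Rightarrow> 'p \<Rightarrow> 'p) \<Rightarrow> 'k \<Rightarrow> 'x \<times> 'p \<Rightarrow> 'x \<times> 'p" where
  "gauge_scale sX sP c = map_prod (sX c) (sP c)"

definition gauge_diff ::
    "('x \<Rightarrow> ('p list \<Rightarrow>\<^sub>0 'a::comm_ring_1) \<Rightarrow> 'p) \<Rightarrow> 'x::zero \<times> 'p \<Rightarrow> 'x \<times> 'p" where
  "gauge_diff \<delta> v = (0, \<delta> (fst v) (wedge []))"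

definition is_gauge_map ::
    "('x::zero \<Rightarrow> ('p::zero list \<Rightarrow>\<^sub>0 'a::comm_ring_1) \<Rightarrow> 'p)
      \<Rightarrow> ('x \<Rightarrow> 'x \<Rightarrow> ('p list \<Rightarrow>\<^sub>0 'k::comm_ring_1) \<Rightarrow> 'x)
      \<Rightarrow> ((('x \<times> 'p) list \<Rightarrow>\<^sub>0 'k) \<Rightarrow> 'x \<times> 'p) \<Rightarrow> bool" where
  "is_gauge_map \<delta> C D \<longleftrightarrow>
     (\<forall>\<xi>. D (wedge [(\<xi>, 0)]) = gauge_diff \<delta> (\<xi>, 0)) \<and>
     (\<forall>\<xi> \<phi>s. \<phi>s \<noteq> [] \<longrightarrow>
        D (wedge ((\<xi>, 0) # map (Pair 0) \<phi>s)) = (0, \<delta> \<xi> (wedge \<phi>s))) \<and>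
     (\<forall>\<xi>1 \<xi>2 \<phi>s.
        D (wedge ((\<xi>1, 0) # (\<xi>2, 0) # map (Pair 0) \<phi>s)) = (C \<xi>1 \<xi>2 (wedge \<phi>s), 0)) \<and>
     (\<forall>\<xi>s \<phi>s. length \<xi>s > 2 \<or> \<xi>s = [] \<longrightarrow>
        D (wedge (map (\<lambda>\<xi>. (\<xi>, 0)) \<xi>s @ map (Pair 0) \<phi>s)) = (0, 0))"

end

theory Submission
  imports Defs "HOL-Library.Multiset"
begin

text \<open>
  A linear map on \<open>\<Lambda>\<^sup>*V\<close> is the same thing as a function of words that is linear in each letter and
  graded symmetric. On words, comultiplication followed by a function \<open>F\<close> of two words is a signed
  sum \<open>unshuffle_sum\<close>, coassociative and graded cocommutative, and a coderivation acts by
  inserting the value of an operation on one part of the word in front of the other part.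

  Insert twice. The second insertion may consume the value of the first, or it may work on a
  disjoint part of the word (\<open>insertion_insertion\<close>). The terms of the second kind are symmetric in
  the two operations up to the sign given by their degrees (\<open>separate_insertions_commute\<close>). Both
  halves of the proof rest on this one fact.

  For an odd operation \<open>D\<close> the terms of the second kind cancel, so the square of the coderivation
  vanishes as soon as \<open>D\<close> composed with it does. By symmetry this has to be verified only on words
  \<open>\<xi>\<^sub>1 \<and> \<dots> \<and> \<xi>\<^sub>r \<and> \<phi>\<^sub>1 \<and> \<dots> \<and> \<phi>\<^sub>n\<close> (\<open>gauge_letter_square\<close>). For \<open>r = 2\<close> the result is the difference of
  \<open>\<delta>\<close> extended to \<open>C \<xi>\<^sub>1 \<xi>\<^sub>2\<close> and the bracket of \<open>\<delta> \<xi>\<^sub>1\<close> and \<open>\<delta> \<xi>\<^sub>2\<close>, which is zero by the BBvD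
  hypothesis. For \<open>r = 3\<close> it is the cyclic sum of \<open>C (C \<xi>\<^sub>1 \<xi>\<^sub>2) \<xi>\<^sub>3 + C \<xi>\<^sub>1 \<xi>\<^sub>2 \<odot> \<delta> \<xi>\<^sub>3\<close>. For other \<open>r\<close>
  there is nothing to cancel.

  For even operations the same fact says that insertion is a pre-Lie product, so that the
  Gerstenhaber bracket satisfies the Jacobi identity (\<open>commutator_jacobi\<close>). The extension of \<open>\<delta>\<close>
  maps the cyclic sum above to the cyclic sum of the iterated brackets of \<open>\<delta> \<xi>\<^sub>1\<close>, \<open>\<delta> \<xi>\<^sub>2\<close>, \<open>\<delta> \<xi>\<^sub>3\<close>
  (\<open>commutator_hat\<close>), hence to zero, and it is injective. In the same way injectivity makes \<open>C\<close>
  antisymmetric, which is what the existence of \<open>D\<close> requires.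

  Elements of \<open>\<Xi> \<oplus> \<Phi>\<close> need not be homogeneous, so words are expanded into words of letters tagged
  with their parity (\<open>tag_sum\<close>). Statements modulo the relations of \<open>\<Lambda>\<^sup>*V\<close> are tested with linear
  functionals (\<open>sym_null_separated\<close>), which turns them into identities between functions of words.
\<close>

section \<open>Signed sums over unshuffles\<close>

text \<open>
  Signs are kept as Booleans: \<open>signed b\<close> multiplies by \<open>-1\<close> when \<open>b\<close> holds, in any abelian group,
  and a product of signs becomes an exclusive or.
\<close>

definition signed :: "bool \<Rightarrow> 'w::ab_group_add \<Rightarrow> 'w" where
  "signed b w = (if b then - w else w)"

lemma signed_False [simp]: "signed False w = w" and signed_zero [simp]: "signed b 0 = 0"
  and signed_signed [simp]: "signed b (signed c w) = signed (b \<noteq> c) w"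
  and signed_add: "signed b (v + w) = signed b v + signed b w"
  by (auto simp: signed_def)

text \<open>
  The parity of the degree of a word, for letters whose odd ones are marked by \<open>par\<close>.
\<close>

definition word_parity :: "('v \<Rightarrow> bool) \<Rightarrow> 'v list \<Rightarrow> bool" where
  "word_parity par xs \<longleftrightarrow> odd (length (filter par xs))"

lemma word_parity_simps [simp]:
  "\<not> word_parity par []" "word_parity par (x # xs) \<longleftrightarrow> par x \<noteq> word_parity par xs"
  "word_parity par (xs @ ys) \<longleftrightarrow> word_parity par xs \<noteq> word_parity par ys"
  by (auto simp: word_parity_def)

lemma word_parity_even [simp]: "\<not> word_parity (\<lambda>_. False) xs"
  by (simp add: word_parity_def)

text \<open>
  This is \<open>F\<close> summed over the graded comultiplication of the word: every letter goes to the left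
  or to the right factor, and a letter that goes to the right has to pass the letters on its right
  that have gone to the left. The recursion makes the laws of the comultiplication provable by
  induction on the word; the sum over unshuffle permutations is recovered in
  \<open>unshuffle_sum_permutations\<close>.
\<close>

primrec unshuffle_sum ::
    "('v \<Rightarrow> bool) \<Rightarrow> 'v list \<Rightarrow> ('v list \<Rightarrow> 'v list \<Rightarrow> 'w::ab_group_add) \<Rightarrow> 'w" where
  "unshuffle_sum par [] F = F [] []"
| "unshuffle_sum par (x # xs) F = unshuffle_sum par xs (\<lambda>a b. F (x # a) b)
     + unshuffle_sum par xs (\<lambda>a b. signed (par x \<and> word_parity par a) (F a (x # b)))"

text \<open>
  The two factors of a word share out its letters, so that lengths and parities add up.
\<close>

lemma unshuffle_sum_mset_cong:
  assumes "\<And>a b. mset a + mset b = mset xs \<Longrightarrow> F a b = G a b"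
  shows "unshuffle_sum par xs F = unshuffle_sum par xs G"
  using assms
proof (induction xs arbitrary: F G)
  case (Cons x xs)
  show ?case
    by (auto intro!: arg_cong2[where f="(+)"] Cons.IH arg_cong[where f="signed _"] Cons.prems)
qed simp

lemma word_parity_mset:
  assumes "mset a + mset b = mset xs"
  shows "word_parity par xs \<longleftrightarrow> word_parity par a \<noteq> word_parity par b"
proof -
  have "mset (filter par xs) = mset (filter par a) + mset (filter par b)"
    using assms[symmetric] by simp
  then have "size (mset (filter par xs)) = size (mset (filter par a) + mset (filter par b))"
    by simp
  then have "length (filter par xs) = length (filter par a) + length (filter par b)"
    by (simp only: size_union size_mset)
  then show ?thesis by (auto simp: word_parity_def)
qed

lemma unshuffle_sum_cong:
  assumes "\<And>a b. word_parity par xs = (word_parity par a \<noteq> word_parity par b) \<Longrightarrow> F a b = G a b"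
  shows "unshuffle_sum par xs F = unshuffle_sum par xs G"
  by (intro unshuffle_sum_mset_cong assms word_parity_mset)

lemma unshuffle_sum_zero [simp]: "unshuffle_sum par xs (\<lambda>a b. 0) = 0"
  by (induction xs) auto

lemma unshuffle_sum_add: "unshuffle_sum par xs (\<lambda>a b. F a b + G a b) = unshuffle_sum par xs F
    + unshuffle_sum par xs G"
  by (induction xs arbitrary: F G) (auto simp: signed_add algebra_simps)

lemma unshuffle_sum_hom:
  assumes "\<And>x y. H (x + y) = H x + H y"
  shows "H (unshuffle_sum par xs F) = unshuffle_sum par xs (\<lambda>a b. H (F a b))"
proof -
  interpret additive H by unfold_locales (rule assms)
  have "H (signed b w) = signed b (H w)" for b w by (simp add: signed_def minus)
  then show ?thesis by (induction xs arbitrary: F) (auto simp: assms)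
qed

lemma unshuffle_sum_signed: "signed c (unshuffle_sum par xs F)
    = unshuffle_sum par xs (\<lambda>a b. signed c (F a b))"
  by (rule unshuffle_sum_hom) (rule signed_add)

lemma unshuffle_sum_minus: "unshuffle_sum par xs (\<lambda>a b. - F a b) = - unshuffle_sum par xs F"
  by (rule unshuffle_sum_hom[symmetric]) simp

lemma unshuffle_sum_diff: "unshuffle_sum par xs (\<lambda>a b. F a b - G a b) = unshuffle_sum par xs F
    - unshuffle_sum par xs G"
  using unshuffle_sum_add[of par xs F "\<lambda>a b. - G a b"] by (simp add: unshuffle_sum_minus)

lemma unshuffle_sum_map: "unshuffle_sum par (map j xs) F
    = unshuffle_sum (par \<circ> j) xs (\<lambda>a b. F (map j a) (map j b))"
  by (induction xs arbitrary: F) (simp_all add: word_parity_def filter_map o_def)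

text \<open>
  Coassociativity: on both sides a letter goes to one of three factors, and the sign for going to
  the last one is multiplicative because parity is additive under concatenation.
\<close>

lemma unshuffle_sum_coassoc:
  "unshuffle_sum par xs (\<lambda>a b. unshuffle_sum par a (\<lambda>c d. F c d b)) =
   unshuffle_sum par xs (\<lambda>c e. unshuffle_sum par e (\<lambda>d b. F c d b))"
proof (induction xs arbitrary: F)
  case (Cons x xs)
  have "unshuffle_sum par xs (\<lambda>a b. signed (par x \<and> word_parity par a)
      (unshuffle_sum par a (\<lambda>c d. F c d (x # b))))
      = unshuffle_sum par xs (\<lambda>a b. unshuffle_sum par a (\<lambda>c d. signed (par x \<and> word_parity par c)
          (signed (par x \<and> word_parity par d) (F c d (x # b)))))"
    by (auto simp: unshuffle_sum_signed intro!: unshuffle_sum_mset_cong unshuffle_sum_cong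
        arg_cong2[where f=signed])
  then show ?case
    using Cons.IH[of "\<lambda>c. F (x # c)"]
      Cons.IH[of "\<lambda>c d b. signed (par x \<and> word_parity par c) (F c (x # d) b)"]
      Cons.IH[of "\<lambda>c d b. signed (par x \<and> word_parity par c)
          (signed (par x \<and> word_parity par d) (F c d (x # b)))"]
    by (simp add: unshuffle_sum_add signed_add unshuffle_sum_signed add.assoc)
qed simp

text \<open>
  Graded cocommutativity: exchanging the factors exchanges the two choices for each letter, and
  the sign \<open>(-1)\<^bsup>|a||b|\<^esup>\<close> supplies the passage of the letter through the other factor.
\<close>

lemma unshuffle_sum_cocomm:
  "unshuffle_sum par xs F = unshuffle_sum par xs
      (\<lambda>a b. signed (word_parity par a \<and> word_parity par b) (F b a))"
proof (induction xs arbitrary: F)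
  case (Cons x xs)
  have "unshuffle_sum par xs (\<lambda>a b. F (x # a) b)
      = unshuffle_sum par xs (\<lambda>a b. signed (par x \<and> word_parity par a)
          (signed (word_parity par a \<and> word_parity par (x # b)) (F (x # b) a)))"
    by (subst Cons.IH) (auto intro!: unshuffle_sum_mset_cong arg_cong2[where f=signed])
  moreover have "unshuffle_sum par xs (\<lambda>a b. signed (par x \<and> word_parity par a) (F a (x # b)))
      = unshuffle_sum par xs (\<lambda>a b. signed (word_parity par (x # a) \<and> word_parity par b)
          (F b (x # a)))"
    by (subst Cons.IH) (auto intro!: unshuffle_sum_mset_cong arg_cong2[where f=signed])
  ultimately show ?case
    unfolding unshuffle_sum.simps by (simp only: add.commute)
qed simp

section \<open>Graded symmetric functions and insertion of operations\<close>

definition graded_symmetric :: "('v \<Rightarrow> bool) \<Rightarrow> ('v list \<Rightarrow> 'w::ab_group_add) \<Rightarrow> bool" where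
  "graded_symmetric par f \<longleftrightarrow> (\<forall>us x y vs. f (us @ x # y # vs)
      = signed (par x \<and> par y) (f (us @ y # x # vs)))"

lemma graded_symmetricD: "graded_symmetric par f \<Longrightarrow> f (us @ x # y # vs)
    = signed (par x \<and> par y) (f (us @ y # x # vs))"
  unfolding graded_symmetric_def by blast

lemma graded_symmetricI:
  "(\<And>us x y vs. f (us @ x # y # vs) = signed (par x \<and> par y) (f (us @ y # x # vs)))
      \<Longrightarrow> graded_symmetric par f"
  unfolding graded_symmetric_def by blast

lemma graded_symmetric_Cons:
  assumes "graded_symmetric par f"
  shows "graded_symmetric par (\<lambda>a. f (x # a))"
proof (rule graded_symmetricI)
  fix us y z vs
  show "f (x # us @ y # z # vs) = signed (par y \<and> par z) (f (x # us @ z # y # vs))"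
    using graded_symmetricD[OF assms, of "x # us" y z vs] by (simp only: append_Cons)
qed

text \<open>
  A sign that depends only on the parity of the argument is insensitive to transpositions, so it
  can be carried through the recursion of \<open>unshuffle_sum\<close>.
\<close>

lemma graded_symmetric_parity_sign:
  assumes "graded_symmetric par f"
  shows "graded_symmetric par (\<lambda>a. signed (c \<and> word_parity par a) (f a))"
proof (rule graded_symmetricI)
  fix us x y vs
  show "signed (c \<and> word_parity par (us @ x # y # vs)) (f (us @ x # y # vs)) =
    signed (par x \<and> par y) (signed (c \<and> word_parity par (us @ y # x # vs)) (f (us @ y # x # vs)))"
    unfolding graded_symmetricD[OF assms, of us x y vs] signed_signed
        by (rule arg_cong2[where f=signed]) auto
qed

lemma graded_symmetric_fixed_sign:
  assumes "graded_symmetric par f"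
  shows "graded_symmetric par (\<lambda>a. signed c (f a))"
proof (rule graded_symmetricI)
  fix us x y vs
  show "signed c (f (us @ x # y # vs)) = signed (par x \<and> par y) (signed c (f (us @ y # x # vs)))"
    unfolding graded_symmetricD[OF assms, of us x y vs] signed_signed
        by (rule arg_cong2[where f=signed]) auto
qed

text \<open>
  Only the two letters being exchanged matter: if both go to the same factor, the symmetry of \<open>F\<close>
  in that factor applies; if they are separated, the two ways of separating them trade places, and
  the sign in the comultiplication records exactly one more inversion.
\<close>

lemma graded_symmetric_unshuffle_sum:
  assumes "\<And>b. graded_symmetric par (\<lambda>a. F a b)" "\<And>a. graded_symmetric par (F a)"
  shows "graded_symmetric par (\<lambda>xs. unshuffle_sum par xs F)"
proof -
  have "unshuffle_sum par (us @ x # y # vs) F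
      = signed (par x \<and> par y) (unshuffle_sum par (us @ y # x # vs) F)"
    for us x y vs using assms
  proof (induction us arbitrary: F)
    case Nil
    have 1: "F (x # y # a) b = signed (par x \<and> par y) (F (y # x # a) b)"
      "F a (x # y # b) = signed (par x \<and> par y) (F a (y # x # b))" for a b
      using graded_symmetricD[OF Nil(1), of "[]" x y a]
          graded_symmetricD[OF Nil(2), of a "[]" x y b] by (simp_all only: append_Nil)
    have 2: "unshuffle_sum par vs (\<lambda>a b. F (x # y # a) b)
        = signed (par x \<and> par y) (unshuffle_sum par vs (\<lambda>a b. F (y # x # a) b))"
      unfolding unshuffle_sum_signed by (intro unshuffle_sum_cong 1)
    have 3: "unshuffle_sum par vs (\<lambda>a b. signed (par y \<and> word_parity par a) (F (x # a) (y # b)))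
        = signed (par x \<and> par y)
            (unshuffle_sum par vs
            (\<lambda>a b. signed (par y \<and> word_parity par (x # a)) (F (x # a) (y # b))))"
      for x y unfolding unshuffle_sum_signed signed_signed
          by (intro unshuffle_sum_cong arg_cong2[where f=signed]) auto
    have 4: "unshuffle_sum par vs
        (\<lambda>a b. signed (par y \<and> word_parity par a)
        (signed (par x \<and> word_parity par a) (F a (x # y # b))))
        = signed (par x \<and> par y)
          (unshuffle_sum par vs
              (\<lambda>a b. signed (par x \<and> word_parity par a)
              (signed (par y \<and> word_parity par a) (F a (y # x # b)))))"
      unfolding unshuffle_sum_signed 1(2) signed_signed
          by (intro unshuffle_sum_cong arg_cong2[where f=signed]) auto
    have 5: "signed (par x \<and> par y)
        (unshuffle_sum par vs (\<lambda>a b. signed (par x \<and> word_parity par a) (F (y # a) (x # b))))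
        = unshuffle_sum par vs (\<lambda>a b. signed (par x \<and> word_parity par (y # a)) (F (y # a) (x # b)))"
      unfolding unshuffle_sum_signed signed_signed
          by (intro unshuffle_sum_cong arg_cong2[where f=signed]) auto
    show ?case
      unfolding append_Nil unshuffle_sum.simps signed_add 2 4 5 3[of y x]
          by (simp only: add.commute add.left_commute add.assoc)
  next
    case (Cons z us)
    have "unshuffle_sum par (us @ x # y # vs) (\<lambda>a. F (z # a))
        = signed (par x \<and> par y) (unshuffle_sum par (us @ y # x # vs) (\<lambda>a. F (z # a)))"
      by (intro Cons.IH graded_symmetric_Cons Cons.prems)
    moreover have "unshuffle_sum par (us @ x # y # vs)
        (\<lambda>a b. signed (par z \<and> word_parity par a) (F a (z # b)))
        = signed (par x \<and> par y)
          (unshuffle_sum par (us @ y # x # vs)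
              (\<lambda>a b. signed (par z \<and> word_parity par a) (F a (z # b))))"
      by (intro Cons.IH graded_symmetric_parity_sign graded_symmetric_fixed_sign
          graded_symmetric_Cons Cons.prems)
    ultimately show ?case by (simp only: append_Cons unshuffle_sum.simps signed_add)
  qed
  then show ?thesis by (rule graded_symmetricI)
qed

text \<open>
  This is \<open>f \<odot> g\<close>, the composite of \<open>f\<close> with the coderivation determined by \<open>g\<close>, on words.
\<close>

definition insertion ::
    "('v \<Rightarrow> bool) \<Rightarrow> ('v list \<Rightarrow> 'w::ab_group_add) \<Rightarrow> ('v list \<Rightarrow> 'v) \<Rightarrow> 'v list \<Rightarrow> 'w" where
  "insertion par f g xs = unshuffle_sum par xs (\<lambda>a b. f (g a # b))"

text \<open>
  The sum of the terms of \<open>(f \<odot> g) \<odot> h\<close> in which \<open>g\<close> and \<open>h\<close> consume disjoint subwords.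
\<close>

definition separate_insertions ::
    "('v \<Rightarrow> bool) \<Rightarrow> ('v list \<Rightarrow> 'w::ab_group_add) \<Rightarrow> ('v list \<Rightarrow> 'v) \<Rightarrow> ('v list \<Rightarrow> 'v)
      \<Rightarrow> 'v list \<Rightarrow> 'w" where
  "separate_insertions par f g h xs = unshuffle_sum par xs (\<lambda>a e. unshuffle_sum par e (\<lambda>b c.
     signed (par (h a) \<and> word_parity par b) (f (g b # h a # c))))"

text \<open>
  The value produced by \<open>h\<close> is a letter of the new word. Either \<open>g\<close> consumes it, or \<open>g\<close> leaves it
  alone; in the second case \<open>g\<close> takes its subword from behind that letter, whence the sign.
\<close>

lemma insertion_insertion:
  "insertion par (insertion par f g) h xs =
     unshuffle_sum par xs (\<lambda>d c. unshuffle_sum par d (\<lambda>a b. f (g (h a # b) # c)))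
         + separate_insertions par f g h xs"
  unfolding insertion_def separate_insertions_def unshuffle_sum.simps unshuffle_sum_add
  by (simp only: unshuffle_sum_coassoc[of par xs "\<lambda>a b c. f (g (h a # b) # c)"])

text \<open>
  The part of an iterated insertion that is not a composition depends symmetrically on \<open>g\<close> and
  \<open>h\<close>, where \<open>p\<close> and \<open>q\<close> are their parities: cocommutativity exchanges the subwords, and graded
  symmetry of \<open>f\<close> exchanges the values. With \<open>p = q = False\<close> this is the right pre-Lie identity,
  and with \<open>g = h\<close> odd it says that the terms cancel in pairs.
\<close>

lemma separate_insertions_commute:
  assumes "graded_symmetric par f"
    and g: "\<And>a. par (g a) = (word_parity par a \<noteq> p)"
        and h: "\<And>a. par (h a) = (word_parity par a \<noteq> q)"
  shows "separate_insertions par f g h xs = signed (p \<and> q) (separate_insertions par f h g xs)"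
proof -
  have swap: "f (g a # h b # c) = signed (par (g a) \<and> par (h b)) (f (h b # g a # c))" for a b c
    using graded_symmetricD[OF assms(1), of "[]" "g a" "h b" c] by (simp only: append_Nil)
  have inner: "unshuffle_sum par d
      (\<lambda>a b. signed (par (h a) \<and> word_parity par b) (f (g b # h a # c)))
      = signed (p \<and> q) (unshuffle_sum par d
          (\<lambda>a b. signed (par (g a) \<and> word_parity par b) (f (h b # g a # c))))" for c d
  proof -
    have "unshuffle_sum par d (\<lambda>a b. signed (par (h a) \<and> word_parity par b) (f (g b # h a # c)))
        = unshuffle_sum par d (\<lambda>a b. signed (word_parity par a \<and> word_parity par b)
            (signed (par (h b) \<and> word_parity par a) (f (g a # h b # c))))"
      by (rule unshuffle_sum_cocomm)
    also have "\<dots> = unshuffle_sum par d (\<lambda>a b. signed (p \<and> q)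
        (signed (par (g a) \<and> word_parity par b) (f (h b # g a # c))))"
      unfolding swap signed_signed g h
          by (intro unshuffle_sum_mset_cong arg_cong2[where f=signed]) auto
    also have "\<dots> = signed (p \<and> q)
        (unshuffle_sum par d (\<lambda>a b. signed (par (g a) \<and> word_parity par b) (f (h b # g a # c))))"
      by (rule unshuffle_sum_signed[symmetric])
    finally show ?thesis .
  qed
  have "separate_insertions par f g h xs = unshuffle_sum par xs (\<lambda>d c. unshuffle_sum par d (\<lambda>a b.
      signed (par (h a) \<and> word_parity par b) (f (g b # h a # c))))"
    unfolding separate_insertions_def by (rule unshuffle_sum_coassoc[symmetric])
  also have "\<dots> = signed (p \<and> q) (unshuffle_sum par xs (\<lambda>d c. unshuffle_sum par d (\<lambda>a b.
      signed (par (g a) \<and> word_parity par b) (f (h b # g a # c)))))"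
    unfolding inner by (rule unshuffle_sum_signed[symmetric])
  also have "\<dots> = signed (p \<and> q) (separate_insertions par f h g xs)"
    unfolding separate_insertions_def by (rule arg_cong[where f="signed _"])
        (rule unshuffle_sum_coassoc)
  finally show ?thesis .
qed

section \<open>Unshuffles as permutations\<close>

lemma sorted_list_of_set_eqI:
  "sorted_wrt (<) (xs :: nat list) \<Longrightarrow> set xs = I \<Longrightarrow> sorted_list_of_set I = xs"
  by (rule strict_sorted_equal) auto

text \<open>
  An unshuffle is determined by the set of positions that go to the left factor. For a strictly
  increasing list of positions the sign counts the pairs in which an element of the right factor
  precedes an element of the left one.
\<close>

lemma unshuffle_sum_subsets:
  assumes "sorted_wrt (<) (is :: nat list)"
  shows "unshuffle_sum q is F = (\<Sum>I\<in>Pow (set is).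
    signed (odd (card {(u, v). u \<in> set is - I \<and> v \<in> I \<and> u < v \<and> q u \<and> q v}))
      (F (sorted_list_of_set I) (sorted_list_of_set (set is - I))))"
  using assms
proof (induction "is" arbitrary: F)
  case (Cons x xs)
  let ?S = "set xs"
  let ?N = "\<lambda>S I. {(u, v). u \<in> S - I \<and> v \<in> I \<and> u < v \<and> q u \<and> q v}"
  have lt: "x < y" if "y \<in> ?S" for y using that Cons.prems by simp
  then have x: "x \<notin> ?S" by blast
  have sorted: "sorted_list_of_set (insert x I) = x # sorted_list_of_set I" if "I \<subseteq> ?S" for I
  proof -
    have "finite I" using that finite_subset by blast
    moreover have "\<forall>y\<in>I. x < y" using that lt by blast
    ultimately show ?thesis
      by (intro sorted_list_of_set_eqI) auto
  qed
  have in_term: "signed (odd (card (?N (insert x ?S) (insert x I))))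
        (F (sorted_list_of_set (insert x I)) (sorted_list_of_set (insert x ?S - insert x I)))
      = signed (odd (card (?N ?S I))) (F (x # sorted_list_of_set I) (sorted_list_of_set (?S - I)))"
    if I: "I \<subseteq> ?S" for I
  proof -
    have "insert x ?S - insert x I = ?S - I" using x by blast
    moreover have "?N (insert x ?S) (insert x I) = ?N ?S I" using x lt by fastforce
    ultimately show ?thesis using sorted[OF I] by simp
  qed
  have out_term: "signed (odd (card (?N (insert x ?S) I)))
        (F (sorted_list_of_set I) (sorted_list_of_set (insert x ?S - I)))
      = signed (odd (card (?N ?S I))) (signed (q x \<and> word_parity q (sorted_list_of_set I))
          (F (sorted_list_of_set I) (x # sorted_list_of_set (?S - I))))"
    if I: "I \<subseteq> ?S" for I
  proof -
    have fin: "finite I" using I finite_subset by blast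
    have 1: "insert x ?S - I = insert x (?S - I)" using x I by blast
    have 2: "word_parity q (sorted_list_of_set I) = odd (card {v \<in> I. q v})"
    proof -
      have "length (filter q (sorted_list_of_set I)) = card (set (filter q (sorted_list_of_set I)))"
        by (rule distinct_card[symmetric]) simp
      also have "set (filter q (sorted_list_of_set I)) = {v \<in> I. q v}" using fin by auto
      finally show ?thesis by (simp add: word_parity_def)
    qed
    have finN: "finite (?N ?S I)"
      by (rule finite_subset[of _ "?S \<times> I"]) (use fin in auto)
    have "?N (insert x ?S) I = ?N ?S I \<union> (if q x then {x} \<times> {v \<in> I. q v} else {})"
      using x I lt by (auto split: if_splits)
    moreover have "card \<dots> = card (?N ?S I) + card (if q x then {x} \<times> {v \<in> I. q v} else {})"
      using x fin finN by (intro card_Un_disjoint) auto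
    ultimately have "card (?N (insert x ?S) I) =
        card (?N ?S I) + (if q x then card {v \<in> I. q v} else 0)"
      by (simp add: card_cartesian_product_singleton split: if_splits)
    then show ?thesis
      unfolding 1 2 signed_signed using sorted[of "?S - I"]
      by (auto intro!: arg_cong2[where f=signed])
  qed
  have split: "(\<Sum>I\<in>Pow (insert x ?S). G I) = (\<Sum>I\<in>Pow ?S. G (insert x I)) + (\<Sum>I\<in>Pow ?S. G I)"
    for G :: "nat set \<Rightarrow> 'w::comm_monoid_add"
  proof -
    have "Pow (insert x ?S) = insert x ` Pow ?S \<union> Pow ?S" by (auto simp: Pow_insert)
    moreover have "insert x ` Pow ?S \<inter> Pow ?S = {}" using x by auto
    moreover have "inj_on (insert x) (Pow ?S)" using x by (auto simp: inj_on_def)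
    ultimately show ?thesis by (simp add: sum.union_disjoint sum.reindex)
  qed
  have "sorted_wrt (<) xs" using Cons.prems by simp
  note IH = Cons.IH[OF this]
  show ?case
    unfolding list.set(2) unshuffle_sum.simps IH split
    by (intro arg_cong2[where f="(+)"] sum.cong refl in_term[symmetric] out_term[symmetric]) auto
qed simp

lemma sorted_list_of_image_prefix:
  assumes "\<sigma> \<in> unshuffles p n" "p \<le> n"
  shows "sorted_list_of_set (\<sigma> ` {..<p}) = map \<sigma> [0..<p]"
    and "sorted_list_of_set ({..<n} - \<sigma> ` {..<p}) = map \<sigma> [p..<n]"
proof -
  have s: "\<sigma> permutes {..<n}" "strict_mono_on {..<p} \<sigma>" "strict_mono_on {p..<n} \<sigma>"
    using assms by (auto simp: unshuffles_def)
  show "sorted_list_of_set (\<sigma> ` {..<p}) = map \<sigma> [0..<p]"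
    by (intro sorted_list_of_set_eqI)
       (auto simp: sorted_wrt_iff_nth_less intro!: strict_mono_onD[OF s(2)])
  have "\<sigma> ` {p..<n} = \<sigma> ` ({..<n} - {..<p})" by (rule arg_cong[where f="image \<sigma>"]) auto
  also have "\<dots> = {..<n} - \<sigma> ` {..<p}"
    using image_set_diff[OF permutes_inj[OF s(1)]] permutes_image[OF s(1)] by (simp only:)
  finally have "\<sigma> ` {p..<n} = {..<n} - \<sigma> ` {..<p}" .
  then show "sorted_list_of_set ({..<n} - \<sigma> ` {..<p}) = map \<sigma> [p..<n]"
    by (intro sorted_list_of_set_eqI)
       (auto simp: sorted_wrt_iff_nth_less intro!: strict_mono_onD[OF s(3)])
qed

text \<open>
  An unshuffle lists a set of positions in increasing order and then its complement in increasing
  order, so it is recovered from the image of the first block.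
\<close>

lemma unshuffle_subset_bij:
  "bij_betw (\<lambda>(p, \<sigma>). \<sigma> ` {..<p}) (Sigma {..n} (\<lambda>p. unshuffles p n)) (Pow {..<n})"
proof (rule bij_betw_imageI)
  show "inj_on (\<lambda>(p, \<sigma>). \<sigma> ` {..<p}) (Sigma {..n} (\<lambda>p. unshuffles p n))"
  proof (rule inj_onI, clarsimp)
    fix p \<sigma> p' \<tau>
    assume *: "p \<le> n" "\<sigma> \<in> unshuffles p n" "p' \<le> n" "\<tau> \<in> unshuffles p' n"
      "\<sigma> ` {..<p} = \<tau> ` {..<p'}"
    have perm: "\<sigma> permutes {..<n}" "\<tau> permutes {..<n}"
      using * by (auto simp: unshuffles_def)
    have "card (\<sigma> ` {..<p}) = p" "card (\<tau> ` {..<p'}) = p'"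
      using perm[THEN permutes_inj] by (simp_all add: card_image inj_on_subset)
    then have p: "p = p'" using *(5) by simp
    have "map \<sigma> [0..<p] = map \<tau> [0..<p]" "map \<sigma> [p..<n] = map \<tau> [p..<n]"
      using sorted_list_of_image_prefix[OF *(2,1)] sorted_list_of_image_prefix[OF *(4,3)] *(5) p
      by (simp_all only:)
    then have "\<sigma> i = \<tau> i" if "i < n" for i
      using that by (cases "i < p") auto
    moreover have "\<sigma> i = \<tau> i" if "\<not> i < n" for i
      using that perm by (auto simp: permutes_def)
    ultimately have "\<sigma> i = \<tau> i" for i by blast
    then show "p = p' \<and> \<sigma> = \<tau>" using p by (simp add: fun_eq_iff)
  qed
  show "(\<lambda>(p, \<sigma>). \<sigma> ` {..<p}) ` Sigma {..n} (\<lambda>p. unshuffles p n) = Pow {..<n}"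
  proof (intro equalityI subsetI)
    fix I assume "I \<in> (\<lambda>(p, \<sigma>). \<sigma> ` {..<p}) ` Sigma {..n} (\<lambda>p. unshuffles p n)"
    then obtain p \<sigma> where *: "p \<le> n" "\<sigma> permutes {..<n}" "I = \<sigma> ` {..<p}"
      by (auto simp: unshuffles_def)
    then have "I \<subseteq> \<sigma> ` {..<n}" by auto
    then show "I \<in> Pow {..<n}" using permutes_image[OF *(2)] by simp
  next
    fix I assume "I \<in> Pow {..<n}"
    then have I: "I \<subseteq> {..<n}" by simp
    then have fin: "finite I" using finite_subset by blast
    \<comment> \<open>List the elements of \<open>I\<close> and then the others, each in increasing order, and fix all \<open>i \<ge> n\<close>.\<close>
    define l where "l = sorted_list_of_set I @ sorted_list_of_set ({..<n} - I)"
    define \<sigma> where "\<sigma> = (\<lambda>i. if i < n then l ! i else i)"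
    have len: "length l = n" "length (sorted_list_of_set I) = card I"
      using I fin card_mono[OF _ I] by (auto simp: l_def card_Diff_subset)
    have cI: "card I \<le> n" using card_mono[OF _ I] by simp
    have "bij_betw (nth l) {..<n} {..<n}"
      by (rule bij_betw_nth) (use I fin len in \<open>auto simp: l_def\<close>)
    then have "bij_betw \<sigma> {..<n} {..<n}"
      by (rule bij_betw_cong[THEN iffD1, rotated]) (simp add: \<sigma>_def)
    then have "\<sigma> permutes {..<n}"
      by (rule bij_imp_permutes) (simp add: \<sigma>_def)
    moreover have "strict_mono_on {..<card I} \<sigma>"
      using cI len(2) by (auto simp: strict_mono_on_def \<sigma>_def l_def nth_append
          intro!: sorted_wrt_nth_less[OF strict_sorted_list_of_set])
    moreover have "strict_mono_on {card I..<n} \<sigma>"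
      using cI len by (auto simp: strict_mono_on_def \<sigma>_def l_def nth_append
          intro!: sorted_wrt_nth_less[OF strict_sorted_list_of_set])
    moreover have "\<sigma> ` {..<card I} = I"
    proof -
      have "\<sigma> ` {..<card I} = nth (sorted_list_of_set I) ` {..<length (sorted_list_of_set I)}"
        using cI len(2) by (intro image_cong) (auto simp: \<sigma>_def l_def nth_append)
      also have "\<dots> = set (sorted_list_of_set I)" by (auto simp: set_conv_nth)
      finally show ?thesis using fin by simp
    qed
    ultimately show "I \<in> (\<lambda>(p, \<sigma>). \<sigma> ` {..<p}) ` Sigma {..n} (\<lambda>p. unshuffles p n)"
      using cI by (intro rev_image_eqI[of "(card I, \<sigma>)"]) (auto simp: unshuffles_def)
  qed
qed

text \<open>
  Both blocks are increasing, so every inversion has one position in each of them.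
\<close>

lemma card_inversions:
  assumes "\<sigma> \<in> unshuffles p n" "p \<le> n"
  shows "card {(i, j). i < j \<and> j < n \<and> \<sigma> j < \<sigma> i \<and> q (\<sigma> i) \<and> q (\<sigma> j)} =
    card {(u, v). u \<in> {..<n} - \<sigma> ` {..<p} \<and> v \<in> \<sigma> ` {..<p} \<and> u < v \<and> q u \<and> q v}"
    (is "card ?A = card ?B")
proof (rule bij_betw_same_card[of "\<lambda>(i, j). (\<sigma> j, \<sigma> i)"])
  have s: "\<sigma> permutes {..<n}" "strict_mono_on {..<p} \<sigma>" "strict_mono_on {p..<n} \<sigma>"
    using assms by (auto simp: unshuffles_def)
  have inj: "inj \<sigma>" by (rule permutes_inj[OF s(1)])
  show "bij_betw (\<lambda>(i, j). (\<sigma> j, \<sigma> i)) ?A ?B"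
  proof (rule bij_betw_imageI)
    show "inj_on (\<lambda>(i, j). (\<sigma> j, \<sigma> i)) ?A"
      using inj by (auto simp: inj_on_def)
    show "(\<lambda>(i, j). (\<sigma> j, \<sigma> i)) ` ?A = ?B"
    proof (intro equalityI subsetI)
      fix w assume "w \<in> (\<lambda>(i, j). (\<sigma> j, \<sigma> i)) ` ?A"
      then obtain i j where w: "w = (\<sigma> j, \<sigma> i)"
          and ij: "i < j" "j < n" "\<sigma> j < \<sigma> i" "q (\<sigma> i)" "q (\<sigma> j)"
        by auto
      have "i < p"
        using ij strict_mono_onD[OF s(3), of i j] by (cases "i < p") auto
      moreover have "\<not> j < p"
        using ij strict_mono_onD[OF s(2), of i j] by auto
      moreover have "\<sigma> j < n" using permutes_in_image[OF s(1), of j] ij by simp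
      ultimately show "w \<in> ?B"
        using w ij inj by (auto simp: inj_image_mem_iff)
    next
      fix w assume "w \<in> ?B"
      then obtain u i where w: "w = (u, \<sigma> i)" "i < p" "u < n" "u \<notin> \<sigma> ` {..<p}" "u < \<sigma> i" "q u"
          "q (\<sigma> i)"
        by auto
      have "u \<in> \<sigma> ` {..<n}" using permutes_image[OF s(1)] w by simp
      then obtain j where j: "u = \<sigma> j" "j < n" by auto
      then have "\<not> j < p" using w by auto
      then have "(i, j) \<in> ?A" using w j by auto
      then show "w \<in> (\<lambda>(i, j). (\<sigma> j, \<sigma> i)) ` ?A" using w j by force
    qed
  qed
qed

text \<open>
  The recursive sum agrees with the sum over unshuffle permutations with Koszul signs. To apply
  the subset description to an arbitrary word, the word is regarded as the image of the list of
  its positions.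
\<close>

lemma unshuffle_sum_permutations:
  "unshuffle_sum par xs F = (\<Sum>p\<le>length xs. \<Sum>\<sigma>\<in>unshuffles p (length xs).
     signed (odd (card {(i, j). i < j \<and> j < length xs \<and> \<sigma> j < \<sigma> i \<and> par (xs ! \<sigma> i)
         \<and> par (xs ! \<sigma> j)}))
       (F (take p (permute_list \<sigma> xs)) (drop p (permute_list \<sigma> xs))))"
proof -
  let ?n = "length xs" and ?q = "par \<circ> nth xs"
  define G where "G I = signed (odd (card {(u, v). u \<in> {..<?n} - I \<and> v \<in> I \<and> u < v \<and> ?q u \<and> ?q v}))
      (F (map (nth xs) (sorted_list_of_set I)) (map (nth xs) (sorted_list_of_set ({..<?n} - I))))"
          for I
  have "unshuffle_sum par xs F = unshuffle_sum par (map (nth xs) [0..<?n]) F"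
      by (simp only: map_nth)
  also have "\<dots> = unshuffle_sum ?q [0..<?n] (\<lambda>a b. F (map (nth xs) a) (map (nth xs) b))"
      by (rule unshuffle_sum_map)
  also have "\<dots> = (\<Sum>I\<in>Pow {..<?n}. G I)"
    by (subst unshuffle_sum_subsets) (simp_all add: G_def atLeast0LessThan)
  also have "\<dots> = (\<Sum>x\<in>Sigma {..?n} (\<lambda>p. unshuffles p ?n). G ((\<lambda>(p, \<sigma>). \<sigma> ` {..<p}) x))"
    by (rule sum.reindex_bij_betw[OF unshuffle_subset_bij, symmetric])
  also have "\<dots> = (\<Sum>p\<le>?n. \<Sum>\<sigma>\<in>unshuffles p ?n. G (\<sigma> ` {..<p}))"
    by (subst sum.Sigma)
      (auto simp: unshuffles_def case_prod_unfold intro: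
          finite_subset[OF _ finite_permutations[of "{..<?n}"]])
  also have "\<dots> = (\<Sum>p\<le>?n. \<Sum>\<sigma>\<in>unshuffles p ?n.
     signed (odd (card {(i, j). i < j \<and> j < ?n \<and> \<sigma> j < \<sigma> i \<and> par (xs ! \<sigma> i) \<and> par (xs ! \<sigma> j)}))
       (F (take p (permute_list \<sigma> xs)) (drop p (permute_list \<sigma> xs))))"
  proof (intro sum.cong refl)
    fix p \<sigma> assume p: "p \<in> {..?n}" and \<sigma>: "\<sigma> \<in> unshuffles p ?n"
    have "p \<le> ?n" using p by simp
    note sl = sorted_list_of_image_prefix[OF \<sigma> this] and ci = card_inversions[OF \<sigma> this, of ?q]
    show "G (\<sigma> ` {..<p}) =
     signed (odd (card {(i, j). i < j \<and> j < ?n \<and> \<sigma> j < \<sigma> i \<and> par (xs ! \<sigma> i) \<and> par (xs ! \<sigma> j)}))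
       (F (take p (permute_list \<sigma> xs)) (drop p (permute_list \<sigma> xs)))"
      using p ci unfolding G_def sl
      by (simp add: permute_list_def take_map drop_map o_def)
  qed
  finally show ?thesis .
qed

lemma koszul_sign_eq:
  "koszul_sign ds \<sigma> = (if odd (card {(i, j). i < j \<and> j < length ds \<and> \<sigma> j < \<sigma> i \<and>
     odd (ds ! \<sigma> i) \<and> odd (ds ! \<sigma> j)}) then - 1 else (1 :: 'r::comm_ring_1))"
proof -
  let ?A = "{(i, j). i < j \<and> j < length ds \<and> \<sigma> j < \<sigma> i}"
  have fin: "finite ?A"
    by (rule finite_subset[of _ "{..<length ds} \<times> {..<length ds}"]) auto
  have "(\<Prod>x\<in>?A. if P x then - 1 else 1) = (- 1 :: 'r) ^ card {x \<in> ?A. P x}" for P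
    using fin by (simp add: prod.inter_filter[symmetric])
  from this[of "\<lambda>(i, j). odd (ds ! \<sigma> i) \<and> odd (ds ! \<sigma> j)"]
  have "koszul_sign ds \<sigma> = (- 1 :: 'r) ^ card
      {x \<in> ?A. case x of (i, j) \<Rightarrow> odd (ds ! \<sigma> i) \<and> odd (ds ! \<sigma> j)}"
    unfolding koszul_sign_def by (simp add: case_prod_unfold)
  also have "{x \<in> ?A. case x of (i, j) \<Rightarrow> odd (ds ! \<sigma> i) \<and> odd (ds ! \<sigma> j)} =
      {(i, j). i < j \<and> j < length ds \<and> \<sigma> j < \<sigma> i \<and> odd (ds ! \<sigma> i) \<and> odd (ds ! \<sigma> j)}"
    by auto
  finally show ?thesis by simp
qed

section \<open>Linear maps on the symmetric coalgebra as functions on words\<close>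

lemma extend_wedge:
  assumes "module t"
  shows "extend t f (wedge xs) = f xs"
proof -
  interpret module t by fact
  show ?thesis by (simp add: extend_def wedge_def)
qed

lemma extend_superset:
  assumes "module t" "finite S" "Poly_Mapping.keys p \<subseteq> S"
  shows "extend t f p = (\<Sum>xs\<in>S. t (Poly_Mapping.lookup p xs) (f xs))"
proof -
  interpret module t by fact
  show ?thesis unfolding extend_def
    by (rule sum.mono_neutral_left) (use assms in \<open>auto simp: in_keys_iff\<close>)
qed

lemma extend_hom:
  assumes "module t"
  shows "module_hom wscale t (extend t f)"
proof -
  interpret module t by fact
  have "extend t f (p + q) = extend t f p + extend t f q" for p q
  proof -
    let ?S = "Poly_Mapping.keys p \<union> Poly_Mapping.keys q"
    have "Poly_Mapping.keys (p + q) \<subseteq> ?S" by (rule keys_add)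
    then show ?thesis
      using extend_superset[OF assms, of ?S]
      by (simp add: lookup_add scale_left_distrib sum.distrib)
  qed
  moreover have "extend t f (wscale c p) = t c (extend t f p)" for c p
  proof -
    have "Poly_Mapping.keys (wscale c p) \<subseteq> Poly_Mapping.keys p" by (auto simp: in_keys_iff)
    then show ?thesis
      using extend_superset[OF assms, of "Poly_Mapping.keys p"]
      by (simp add: scale_sum_right)
  qed
  ultimately show ?thesis using assms module_wscale by (simp add: module_hom_iff)
qed

lemma wscale_wedge: "wscale c (wedge xs) = Poly_Mapping.single xs c"
  by (rule poly_mapping_eqI) (simp add: wedge_def lookup_single when_def)

lemma hom_eq_extend:
  assumes "module_hom wscale t F"
  shows "F p = extend t (\<lambda>xs. F (wedge xs)) p"
proof -
  interpret module_hom wscale t F by fact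
  have "p = (\<Sum>xs\<in>Poly_Mapping.keys p. wscale (Poly_Mapping.lookup p xs) (wedge xs))"
    by (rule poly_mapping_eqI)
      (simp add: wscale_wedge lookup_sum lookup_single when_def in_keys_iff del: lookup_wscale)
  then have "F p = F (\<Sum>xs\<in>Poly_Mapping.keys p. wscale (Poly_Mapping.lookup p xs) (wedge xs))"
    by simp
  then show ?thesis by (simp add: extend_def sum scale)
qed

text \<open>
  Words form a basis of the free module.
\<close>

lemma hom_eqI:
  assumes "module_hom wscale t F" "module_hom wscale t G" "\<And>xs. F (wedge xs) = G (wedge xs)"
  shows "F = G"
proof
  fix p
  have "F p = extend t (\<lambda>xs. F (wedge xs)) p" by (rule hom_eq_extend[OF assms(1)])
  also have "\<dots> = G p" unfolding assms(3) by (rule hom_eq_extend[OF assms(2), symmetric])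
  finally show "F p = G p" .
qed

text \<open>
  Linearity in each letter of the form \<open>j x\<close>. For \<open>j\<close> the identity this is multilinearity; with
  \<open>j\<close> an injection into a sum type it expresses linearity in the letters of one degree only.
\<close>

definition letter_linear ::
    "('r::comm_ring_1 \<Rightarrow> 'u::ab_group_add \<Rightarrow> 'u) \<Rightarrow> ('r \<Rightarrow> 'w::ab_group_add \<Rightarrow> 'w)
      \<Rightarrow> ('u \<Rightarrow> 'v) \<Rightarrow> ('v list \<Rightarrow> 'w) \<Rightarrow> bool" where
  "letter_linear s t j f \<longleftrightarrow> (\<forall>us vs. module_hom s t (\<lambda>x. f (us @ j x # vs)))"

lemma letter_linearD: "letter_linear s t j f \<Longrightarrow> module_hom s t (\<lambda>x. f (us @ j x # vs))"
  unfolding letter_linear_def by blast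

lemma sym_hom_hom: "F \<in> sym_hom s V t \<Longrightarrow> module_hom wscale t F"
  by (simp add: sym_hom_def)

lemma sym_hom_zero: "F \<in> sym_hom s V t \<Longrightarrow> w \<in> sym_relations s V \<Longrightarrow> F w = 0"
  by (auto simp: sym_hom_def sym_null_def intro: module.span_base[OF module_wscale])

lemma sym_hom_letter_linear:
  assumes "F \<in> sym_hom s V t" "module s"
  shows "letter_linear s t (\<lambda>x. x) (\<lambda>xs. F (wedge xs))"
proof -
  interpret module_hom wscale t F by (rule sym_hom_hom) fact
  show ?thesis
    unfolding letter_linear_def module_hom_iff
  proof (intro allI conjI)
    fix us vs x y c
    have "F (wedge (us @ (x + y) # vs) - wedge (us @ x # vs) - wedge (us @ y # vs)) = 0"
      by (rule sym_hom_zero[OF assms(1)]) (unfold sym_relations_def, blast)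
    then show "F (wedge (us @ (x + y) # vs)) = F (wedge (us @ x # vs)) + F (wedge (us @ y # vs))"
      unfolding diff by (simp add: algebra_simps)
    have "F (wedge (us @ s c x # vs) - wscale c (wedge (us @ x # vs))) = 0"
      by (rule sym_hom_zero[OF assms(1)]) (unfold sym_relations_def, blast)
    then show "F (wedge (us @ s c x # vs)) = t c (F (wedge (us @ x # vs)))"
      by (simp add: diff scale)
  qed (use assms m2.module_axioms in auto)
qed

lemma sym_hom_swap:
  assumes "F \<in> sym_hom s V t" "x \<in> V i" "y \<in> V j"
  shows "F (wedge (us @ x # y # vs)) = signed (odd i \<and> odd j) (F (wedge (us @ y # x # vs)))"
proof -
  interpret module_hom wscale t F by (rule sym_hom_hom) fact
  have "F (wedge (us @ x # y # vs)
      - wscale (if odd i \<and> odd j then - 1 else 1) (wedge (us @ y # x # vs))) = 0"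
    by (rule sym_hom_zero[OF assms(1)]) (unfold sym_relations_def, use assms(2,3) in blast)
  then show ?thesis
    by (simp add: diff scale signed_def del: minus_add_distrib split: if_splits)
qed

text \<open>
  Together with \<open>sym_hom_letter_linear\<close> and \<open>sym_hom_swap\<close>, this identifies linear maps on the
  symmetric coalgebra with graded symmetric multilinear functions of words. It suffices to look at
  the generators of \<open>sym_null\<close>, because the kernel of a linear map is a submodule.
\<close>

lemma sym_homI:
  assumes F: "module_hom wscale t F" and mult: "letter_linear s t (\<lambda>x. x) (\<lambda>xs. F (wedge xs))"
    and swap: "\<And>us x y vs i j. x \<in> V i \<Longrightarrow> y \<in> V j \<Longrightarrow>
      F (wedge (us @ x # y # vs)) = signed (odd i \<and> odd j) (F (wedge (us @ y # x # vs)))"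
  shows "F \<in> sym_hom s V t"
proof -
  interpret module_hom wscale t F by fact
  have rel: "F w = 0" if "w \<in> sym_relations s V" for w
  proof -
    note m = mult[unfolded letter_linear_def module_hom_iff, rule_format]
    from that consider
      us x y vs where "w = wedge (us @ (x + y) # vs) - wedge (us @ x # vs) - wedge (us @ y # vs)"
      | us c x vs where "w = wedge (us @ s c x # vs) - wscale c (wedge (us @ x # vs))"
      | us x y vs i j where "x \<in> V i" "y \<in> V j" "w = wedge (us @ x # y # vs)
          - wscale (if odd i \<and> odd j then - 1 else 1) (wedge (us @ y # x # vs))"
      unfolding sym_relations_def by blast
    then show ?thesis
    proof cases
      case 1 then show ?thesis using m by (simp add: diff)
    next
      case 2 then show ?thesis using m by (simp add: diff scale)
    next
      case 3
      show ?thesis unfolding 3(3) diff scale swap[OF 3(1,2)] by (auto simp: signed_def)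
    qed
  qed
  have "m1.span (sym_relations s V) \<subseteq> {w. F w = 0}"
    by (rule m1.span_minimal) (auto simp: rel subspace_kernel)
  then show ?thesis using F by (auto simp: sym_hom_def sym_null_def)
qed

text \<open>
  Over a field the null space is the intersection of the kernels of the functionals vanishing on
  it. Congruences in the free module can therefore be checked as equations between scalars, where
  the calculus of graded symmetric functions applies.
\<close>

lemma sym_null_separated:
  fixes s :: "'k::field \<Rightarrow> 'v::ab_group_add \<Rightarrow> 'v"
  assumes "\<And>\<psi>. \<psi> \<in> sym_hom s V (*) \<Longrightarrow> \<psi> w = 0"
  shows "w \<in> sym_null s V"
proof (rule ccontr)
  assume w: "w \<notin> sym_null s V"
  interpret W: vector_space "wscale :: 'k \<Rightarrow> ('v list \<Rightarrow>\<^sub>0 'k) \<Rightarrow> _"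
    using module_wscale module_iff_vector_space by blast
  interpret K: vector_space "(*) :: 'k \<Rightarrow> 'k \<Rightarrow> 'k"
    by unfold_locales (auto simp: algebra_simps)
  interpret WK: vector_space_pair "wscale :: 'k \<Rightarrow> ('v list \<Rightarrow>\<^sub>0 'k) \<Rightarrow> _" "(*) :: 'k \<Rightarrow> 'k \<Rightarrow> 'k" ..
  obtain B where B: "B \<subseteq> sym_relations s V" "W.independent B" "sym_relations s V \<subseteq> W.span B"
    using W.maximal_independent_subset by blast
  have null: "sym_null s V = W.span B"
    unfolding sym_null_def using B W.span_mono W.span_span W.span_minimal by (metis subset_antisym)
  have "W.independent (insert w B)"
    using w B(2) unfolding null by (rule W.independent_insertI)
  \<comment> \<open>A functional that vanishes on a basis of the null space and takes the value \<open>1\<close> at \<open>w\<close>.\<close>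
  then obtain \<psi> where lin: "Vector_Spaces.linear wscale (*) \<psi>"
    and \<psi>: "\<forall>x\<in>insert w B. \<psi> x = (if x = w then 1 else 0)"
    using WK.linear_independent_extend[of "insert w B" "\<lambda>x. if x = w then 1 else 0"] by blast
  then have hom: "module_hom wscale (*) \<psi>" by (simp add: module_hom_iff_linear)
  interpret \<psi>: module_hom wscale "(*)" \<psi> by fact
  have "w \<notin> B" using w unfolding null by (auto intro: W.span_base)
  then have "W.span B \<subseteq> {x. \<psi> x = 0}"
    by (intro W.span_minimal) (use \<psi> \<psi>.subspace_kernel in auto)
  then have "\<psi> \<in> sym_hom s V (*)"
    unfolding sym_hom_def null using hom by auto
  with assms \<psi> show False by fastforce
qed

lemma letter_linear_signed:
  assumes "letter_linear s t j f"
  shows "letter_linear s t j (\<lambda>a. signed c (f a))"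
  unfolding letter_linear_def
proof (intro allI)
  fix us vs
  interpret module_hom s t "\<lambda>x. f (us @ j x # vs)" by (rule letter_linearD[OF assms])
  show "module_hom s t (\<lambda>x. signed c (f (us @ j x # vs)))"
    using module_hom_axioms by (auto simp: module_hom_iff signed_def m2.scale_minus_right)
qed

lemma module_hom_unshuffle_sum:
  assumes "\<And>a b. module_hom s t (\<lambda>x. G x a b)"
  shows "module_hom s t (\<lambda>x. unshuffle_sum par vs (G x))"
proof -
  note G = assms[unfolded module_hom_iff]
  interpret module t using G by blast
  have "unshuffle_sum par vs (\<lambda>a b. t c (G x a b)) = t c (unshuffle_sum par vs (G x))" for c x
    by (rule unshuffle_sum_hom[symmetric]) (rule scale_right_distrib)
  moreover have "G (x + y) = (\<lambda>a b. G x a b + G y a b)" "G (s c x) = (\<lambda>a b. t c (G x a b))"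
      for x y c
    using G by (auto simp: fun_eq_iff)
  ultimately show ?thesis
    using G by (auto simp: module_hom_iff unshuffle_sum_add)
qed

lemma hom_plus:
  assumes "module_hom s t f" "module_hom s t g"
  shows "module_hom s t (\<lambda>x. f x + g x)"
proof -
  interpret module t using assms by (simp add: module_hom_iff)
  show ?thesis using assms by (auto simp: module_hom_iff algebra_simps)
qed

lemma letter_linear_unshuffle_sum:
  assumes "\<And>b. letter_linear s t j (\<lambda>a. F a b)" "\<And>a. letter_linear s t j (F a)" "\<And>x. par (j x) = q"
  shows "letter_linear s t j (\<lambda>xs. unshuffle_sum par xs F)"
proof -
  have "module_hom s t (\<lambda>x. unshuffle_sum par (us @ j x # vs) F)" for us vs
    using assms(1,2)
  proof (induction us arbitrary: F)
    case Nil
    have *: "module_hom s t (\<lambda>x. F (j x # a) b)"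
      "module_hom s t (\<lambda>x. signed (q \<and> word_parity par a) (F a (j x # b)))" for a b
      using Nil(1)[of b, THEN letter_linearD, of "[]" a]
        Nil(2)[of a, THEN letter_linear_signed, THEN letter_linearD, of "q
            \<and> word_parity par a" "[]" b] by simp_all
    show ?case
      unfolding append_Nil unshuffle_sum.simps assms(3)
      by (intro hom_plus module_hom_unshuffle_sum *)
  next
    case (Cons z us)
    have "letter_linear s t j (\<lambda>a. F (z # a) b)" for b
      using Cons.prems(1)[of b, THEN letter_linearD, of "z # _"] by (simp add: letter_linear_def)
    moreover have "letter_linear s t j (F (z # a))" for a
      by (rule Cons.prems)
    ultimately have 1: "module_hom s t (\<lambda>x. unshuffle_sum par (us @ j x # vs) (\<lambda>a. F (z # a)))"
      by (rule Cons.IH)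
    have "letter_linear s t j (\<lambda>a. signed (par z \<and> word_parity par a) (F a (z # b)))" for b
      using Cons.prems(1)[of "z # b", THEN letter_linear_signed, THEN letter_linearD] assms(3)
      by (simp add: letter_linear_def)
    moreover have "letter_linear s t j (\<lambda>b. signed (par z \<and> word_parity par a) (F a (z # b)))" for a
      using Cons.prems(2)[of a, THEN letter_linear_signed, THEN letter_linearD, of _ "z # _"]
      by (simp add: letter_linear_def)
    ultimately have 2: "module_hom s t (\<lambda>x. unshuffle_sum par (us @ j x # vs)
        (\<lambda>a b. signed (par z \<and> word_parity par a) (F a (z # b))))"
      by (rule Cons.IH)
    show ?case unfolding append_Cons unshuffle_sum.simps by (rule hom_plus[OF 1 2])
  qed
  then show ?thesis by (simp add: letter_linear_def)
qed

section \<open>The Gerstenhaber bracket and the extension of a gauge action\<close>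

abbreviation even_letters :: "'v \<Rightarrow> bool" where "even_letters \<equiv> \<lambda>_. False"

lemma unshuffle_sum_even_cocomm: "unshuffle_sum even_letters xs F
    = unshuffle_sum even_letters xs (\<lambda>a b. F b a)"
  using unshuffle_sum_cocomm[of even_letters xs F] by simp

text \<open>
  The Gerstenhaber bracket, on words.
\<close>

definition commutator :: "('p list \<Rightarrow> 'p) \<Rightarrow> ('p list \<Rightarrow> 'p) \<Rightarrow> 'p list \<Rightarrow> 'p::ab_group_add" where
  "commutator f g xs = insertion even_letters f g xs - insertion even_letters g f xs"

definition head_additive :: "('v::ab_group_add list \<Rightarrow> 'w::ab_group_add) \<Rightarrow> bool" where
  "head_additive f \<longleftrightarrow> (\<forall>x y vs. f ((x + y) # vs) = f (x # vs) + f (y # vs))"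

lemma unshuffle_sum_in_head:
  assumes "head_additive f"
  shows "f (unshuffle_sum par xs G # vs) = unshuffle_sum par xs (\<lambda>a b. f (G a b # vs))"
  by (rule unshuffle_sum_hom[where H="\<lambda>x. f (x # vs)"]) (use assms in \<open>simp add: head_additive_def\<close>)

lemma insertion_diff_left:
  "insertion par (\<lambda>xs. f xs - g xs) h xs = insertion par f h xs - insertion par g h xs"
  by (simp add: insertion_def unshuffle_sum_diff)

lemma insertion_diff_right:
  assumes "head_additive f"
  shows "insertion par f (\<lambda>xs. g xs - h xs) xs = insertion par f g xs - insertion par f h xs"
proof -
  have "f ((x - y) # vs) = f (x # vs) - f (y # vs)" for x y vs
    using assms unfolding head_additive_def by (metis add_diff_cancel_right' diff_add_cancel)
  then show ?thesis by (simp add: insertion_def unshuffle_sum_diff)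
qed

text \<open>
  The associator of insertion consists of the separate insertions, which are symmetric in \<open>g\<close> and
  \<open>h\<close>. So insertion is a right pre-Lie product.
\<close>

lemma insertion_assoc:
  assumes "head_additive f"
  shows "insertion par (insertion par f g) h xs =
    insertion par f (insertion par g h) xs + separate_insertions par f g h xs"
proof -
  have "f (insertion par g h d # c) = unshuffle_sum par d (\<lambda>a b. f (g (h a # b) # c))" for c d
    unfolding insertion_def[of par g] by (rule unshuffle_sum_in_head[OF assms])
  then show ?thesis unfolding insertion_insertion by (simp only: insertion_def[of par f])
qed

text \<open>
  The commutator of a pre-Lie product satisfies the Jacobi identity: associators cancel by their
  symmetry, and what is left cancels as in an associative algebra.
\<close>

lemma commutator_jacobi:
  assumes "graded_symmetric even_letters f" "graded_symmetric even_letters g"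
      "graded_symmetric even_letters h"
    and "head_additive f" "head_additive g" "head_additive h"
  shows "commutator (commutator f g) h xs + commutator (commutator g h) f xs
    + commutator (commutator h f) g xs = 0"
proof -
  have cc: "separate_insertions even_letters f g h xs = separate_insertions even_letters f h g xs"
    if "graded_symmetric even_letters f" for f g h :: "'a list \<Rightarrow> 'a"
    using separate_insertions_commute[OF that, where g=g and h=h and p=False and q=False] by simp
  show ?thesis
    unfolding commutator_def[abs_def] insertion_diff_left
    using assms
    by (simp add: insertion_diff_right insertion_assoc cc[of f g h] cc[of g h f] cc[of h f g])
qed

text \<open>
  The extension of \<open>d\<close> to operations \<open>\<pi>\<close> with values in the gauge parameters, on words.
\<close>

definition hat_words :: "('x \<Rightarrow> 'p list \<Rightarrow> 'p::ab_group_add) \<Rightarrow> ('p list \<Rightarrow> 'x) \<Rightarrow> 'p list \<Rightarrow> 'p" where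
  "hat_words d \<pi> xs = unshuffle_sum even_letters xs (\<lambda>a b. d (\<pi> a) b)"

text \<open>
  In the Lie algebra of field dependent gauge parameters, this is the bracket of \<open>\<pi>\<close> with the
  operation that is \<open>\<eta>\<close> on the empty word and zero on all others: of the three terms of that
  bracket, the one in which a value is inserted into the second operation vanishes.
\<close>

definition parameter_bracket ::
    "('x \<Rightarrow> 'p list \<Rightarrow> 'p::ab_group_add) \<Rightarrow> ('x \<Rightarrow> 'x \<Rightarrow> 'p list \<Rightarrow> 'x::ab_group_add)
      \<Rightarrow> ('p list \<Rightarrow> 'x) \<Rightarrow> 'x \<Rightarrow> 'p list \<Rightarrow> 'x" where
  "parameter_bracket d c \<pi> \<eta> xs =
     insertion even_letters \<pi> (d \<eta>) xs + unshuffle_sum even_letters xs (\<lambda>a b. c (\<pi> a) \<eta> b)"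

text \<open>
  The extension of \<open>d\<close> intertwines brackets. When \<open>d \<eta>\<close> is inserted into the extension of \<open>\<pi>\<close>, its
  value becomes an argument either of \<open>\<pi>\<close> or of the gauge transformation that \<open>\<pi>\<close> produces. The
  terms of the first kind form the extension of \<open>\<pi> \<odot> d \<eta>\<close>. Those of the second kind combine with
  the insertion of the extension of \<open>\<pi>\<close> into \<open>d \<eta>\<close> to commutators of gauge transformations
  \<open>d (\<pi> a)\<close> with \<open>d \<eta>\<close>, and these are rewritten by the hypothesis \<open>comm\<close>.
\<close>

lemma commutator_hat:
  assumes add: "\<And>\<xi> \<eta> xs. d (\<xi> + \<eta>) xs = d \<xi> xs + d \<eta> xs"
    and head: "\<And>\<xi>. head_additive (d \<xi>)"
    and comm: "\<And>\<xi> \<eta> xs. commutator (d \<xi>) (d \<eta>) xs = hat_words d (c \<xi> \<eta>) xs"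
  shows "commutator (hat_words d \<pi>) (d \<eta>) xs = hat_words d (parameter_bracket d c \<pi> \<eta>) xs"
proof -
  let ?u = "unshuffle_sum even_letters"
  have pull: "d (?u a G) b = ?u a (\<lambda>a1 a2. d (G a1 a2) b)" for a b G
    by (rule unshuffle_sum_hom[where H="\<lambda>\<xi>. d \<xi> b"]) (rule add)
  have "insertion even_letters (hat_words d \<pi>) (d \<eta>) xs
      = ?u xs (\<lambda>a b. ?u b (\<lambda>b1 b2. d (\<pi> (d \<eta> a # b1)) b2))
        + ?u xs (\<lambda>a b. ?u b (\<lambda>b1 b2. d (\<pi> b1) (d \<eta> a # b2)))"
    by (simp add: insertion_def hat_words_def unshuffle_sum_add)
  also have "?u xs (\<lambda>a b. ?u b (\<lambda>b1 b2. d (\<pi> (d \<eta> a # b1)) b2))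
      = ?u xs (\<lambda>e b2. ?u e (\<lambda>a b1. d (\<pi> (d \<eta> a # b1)) b2))"
    by (rule unshuffle_sum_coassoc[symmetric])
  also have "\<dots> = hat_words d (insertion even_letters \<pi> (d \<eta>)) xs"
    unfolding hat_words_def insertion_def pull ..
  also have "?u xs (\<lambda>a b. ?u b (\<lambda>b1 b2. d (\<pi> b1) (d \<eta> a # b2)))
      = ?u xs (\<lambda>e b2. ?u e (\<lambda>a b1. d (\<pi> b1) (d \<eta> a # b2)))"
    by (rule unshuffle_sum_coassoc[symmetric])
  also have "(\<lambda>e b2. ?u e (\<lambda>a b1. d (\<pi> b1) (d \<eta> a # b2)))
      = (\<lambda>e b2. ?u e (\<lambda>b1 a. d (\<pi> b1) (d \<eta> a # b2)))"
    by (intro ext unshuffle_sum_even_cocomm)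
  also have "?u xs \<dots> = ?u xs (\<lambda>b1 e. insertion even_letters (d (\<pi> b1)) (d \<eta>) e)"
    unfolding insertion_def by (rule unshuffle_sum_coassoc)
  finally have 1: "insertion even_letters (hat_words d \<pi>) (d \<eta>) xs
      = hat_words d (insertion even_letters \<pi> (d \<eta>)) xs
      + ?u xs (\<lambda>b1 e. insertion even_letters (d (\<pi> b1)) (d \<eta>) e)" .
  have 2: "insertion even_letters (d \<eta>) (hat_words d \<pi>) xs
      = ?u xs (\<lambda>a1 e. insertion even_letters (d \<eta>) (d (\<pi> a1)) e)"
    unfolding insertion_def hat_words_def unshuffle_sum_in_head[OF head]
        by (rule unshuffle_sum_coassoc)
  have "?u xs (\<lambda>a1 e. commutator (d (\<pi> a1)) (d \<eta>) e)
      = ?u xs (\<lambda>e b. ?u e (\<lambda>a1 a2. d (c (\<pi> a1) \<eta> a2) b))"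
    unfolding comm hat_words_def by (rule unshuffle_sum_coassoc[symmetric])
  also have "\<dots> = hat_words d (\<lambda>e. ?u e (\<lambda>a1 a2. c (\<pi> a1) \<eta> a2)) xs"
    unfolding hat_words_def pull ..
  finally have 3: "?u xs (\<lambda>a1 e. commutator (d (\<pi> a1)) (d \<eta>) e)
      = hat_words d (\<lambda>e. ?u e (\<lambda>a1 a2. c (\<pi> a1) \<eta> a2)) xs" .
  show ?thesis
    using 3 unfolding commutator_def 1 2 unshuffle_sum_diff
    by (simp add: hat_words_def parameter_bracket_def add unshuffle_sum_add algebra_simps)
qed

text \<open>
  By \<open>commutator_hat\<close>, applied to \<open>\<pi> = c \<xi>1 \<xi>2\<close> and its cyclic permutations, the three summands
  are mapped to the three iterated commutators of gauge transformations.
\<close>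

lemma hat_cyclic_sum:
  assumes add: "\<And>\<xi> \<eta> xs. d (\<xi> + \<eta>) xs = d \<xi> xs + d \<eta> xs"
    and head: "\<And>\<xi>. head_additive (d \<xi>)"
    and sym: "\<And>\<xi>. graded_symmetric even_letters (d \<xi>)"
    and comm: "\<And>\<xi> \<eta> xs. commutator (d \<xi>) (d \<eta>) xs = hat_words d (c \<xi> \<eta>) xs"
  shows "hat_words d (\<lambda>a. parameter_bracket d c (c \<xi>1 \<xi>2) \<xi>3 a
      + parameter_bracket d c (c \<xi>2 \<xi>3) \<xi>1 a
    + parameter_bracket d c (c \<xi>3 \<xi>1) \<xi>2 a) xs = 0"
proof -
  have eq: "hat_words d (c \<xi> \<eta>) = commutator (d \<xi>) (d \<eta>)" for \<xi> \<eta> by (simp add: comm fun_eq_iff)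
  have "hat_words d (parameter_bracket d c (c \<xi> \<eta>) \<zeta>) xs
      = commutator (commutator (d \<xi>) (d \<eta>)) (d \<zeta>) xs" for \<xi> \<eta> \<zeta>
    using commutator_hat[OF add head comm, of "c \<xi> \<eta>" \<zeta> xs] by (simp add: eq)
  then show ?thesis
    using commutator_jacobi[OF sym sym sym head head head, of \<xi>1 \<xi>2 \<xi>3 xs]
    by (simp add: hat_words_def add unshuffle_sum_add)
qed

section \<open>Words in tagged letters\<close>

lemma hom_compose:
  assumes "module_hom s t f" "module_hom t u g"
  shows "module_hom s u (\<lambda>x. g (f x))"
  using assms by (simp add: module_hom_iff)

lemma hom_zero: "module s \<Longrightarrow> module t \<Longrightarrow> module_hom s t (\<lambda>x. 0)"
  by (simp add: module_hom_iff module.scale_zero_right)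

lemma hom_signed:
  assumes "module_hom s t f"
  shows "f (signed c x) = signed c (f x)"
proof -
  interpret module_hom s t f by fact
  show ?thesis by (simp add: signed_def neg)
qed

abbreviation (input) gauge_degrees :: "int \<Rightarrow> ('x::zero \<times> 'p::zero) set" where
  "gauge_degrees \<equiv> desuspension gauge_grading"

text \<open>
  Koszul signs make sense for homogeneous letters only, and zero is homogeneous of every degree. A
  tagged letter carries its parity along: the parameters, on the left, are odd after desuspension,
  and the fields, on the right, are even.
\<close>

primrec untag :: "'x::zero + 'p::zero \<Rightarrow> 'x \<times> 'p" where
  "untag (Inl x) = (x, 0)"
| "untag (Inr p) = (0, p)"

text \<open>
  A vanishing letter may be given the tag that matches any prescribed degree, so no homogeneous
  word is exceptional.
\<close>

lemma homogeneous_untag: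
  assumes "v \<in> gauge_degrees i"
  obtains t where "v = untag t" "isl t = odd i"
proof -
  consider "i = - 1" "snd v = 0" | "i = 0" "fst v = 0" | "v = (0, 0)"
    using assms by (auto simp: desuspension_def gauge_grading_def split: if_splits)
  then show ?thesis
  proof cases
    case 1 then show ?thesis using that[of "Inl (fst v)"] by (cases v) auto
  next
    case 2 then show ?thesis using that[of "Inr (snd v)"] by (cases v) auto
  next
    case 3 then show ?thesis using that[of "if odd i then Inl 0 else Inr 0"] by auto
  qed
qed

text \<open>
  The value on a word of pairs of the multilinear extension of a function of tagged words: each
  letter is split into its homogeneous components.
\<close>

primrec tag_sum :: "('x \<times> 'p) list \<Rightarrow> (('x + 'p) list \<Rightarrow> 'w::ab_group_add) \<Rightarrow> 'w" where
  "tag_sum [] F = F []"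
| "tag_sum (v # vs) F = tag_sum vs (\<lambda>a. F (Inl (fst v) # a)) + tag_sum vs (\<lambda>a. F (Inr (snd v) # a))"

lemma tag_sum_zero [simp]: "tag_sum vs (\<lambda>a. 0) = 0"
  by (induction vs) auto

lemma tag_sum_hom:
  assumes "\<And>x y. H (x + y) = H x + H y"
  shows "H (tag_sum vs F) = tag_sum vs (\<lambda>a. H (F a))"
  by (induction vs arbitrary: F) (auto simp: assms)

lemma tag_sum_signed: "signed c (tag_sum vs F) = tag_sum vs (\<lambda>a. signed c (F a))"
  by (rule tag_sum_hom) (rule signed_add)

definition tag_linear where
  "tag_linear sX sP t f \<longleftrightarrow> letter_linear sX t Inl f \<and> letter_linear sP t Inr f"

lemma letter_linear_Cons:
  assumes "letter_linear s t j f" shows "letter_linear s t j (\<lambda>a. f (z # a))"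
  unfolding letter_linear_def using letter_linearD[OF assms, of "z # _"] by simp

lemma tag_linear_Cons: "tag_linear sX sP t f \<Longrightarrow> tag_linear sX sP t (\<lambda>a. f (z # a))"
  unfolding tag_linear_def by (blast intro: letter_linear_Cons)

lemma hom_at_zero: "module_hom s t f \<Longrightarrow> f 0 = 0"
  by (rule module_hom.zero)

lemma letter_linear_zero: "letter_linear s t j f \<Longrightarrow> f (us @ j 0 # vs) = 0"
  by (rule hom_at_zero[OF letter_linearD])

lemma tag_sum_untag_Cons:
  assumes "tag_linear sX sP t f"
  shows "tag_sum (untag z # vs) f = tag_sum vs (\<lambda>a. f (z # a))"
proof -
  have "f (Inl 0 # a) = 0" "f (Inr 0 # a) = 0" for a
    using assms letter_linear_zero[of _ _ Inl f "[]" a] letter_linear_zero[of _ _ Inr f "[]" a]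
    by (auto simp: tag_linear_def)
  then show ?thesis by (cases z) simp_all
qed

text \<open>
  For a word that is already homogeneous all other terms of the expansion contain a zero letter.
\<close>

lemma tag_sum_untag:
  assumes "tag_linear sX sP t f"
  shows "tag_sum (map untag ts) f = f ts"
  using assms
proof (induction ts arbitrary: f)
  case (Cons z ts)
  then show ?case by (simp only: list.map tag_sum_untag_Cons tag_linear_Cons)
qed simp

lemma tag_sum_swap:
  assumes "tag_linear sX sP t f" "graded_symmetric isl f"
  shows "tag_sum (us @ untag x # untag y # vs) f
      = signed (isl x \<and> isl y) (tag_sum (us @ untag y # untag x # vs) f)"
  using assms
proof (induction us arbitrary: f)
  case Nil
  have "f (x # y # a) = signed (isl x \<and> isl y) (f (y # x # a))" for a
    using graded_symmetricD[OF Nil(2), of "[]" x y a] by (simp only: append_Nil)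
  then show ?case
    unfolding append_Nil tag_sum_untag_Cons[OF Nil(1)]
        tag_sum_untag_Cons[OF tag_linear_Cons[OF Nil(1)]] tag_sum_signed
    by (simp only:)
next
  case (Cons v us)
  have "tag_sum (us @ untag x # untag y # vs) (\<lambda>a. f (z # a))
      = signed (isl x \<and> isl y) (tag_sum (us @ untag y # untag x # vs) (\<lambda>a. f (z # a)))" for z
    by (intro Cons.IH tag_linear_Cons graded_symmetric_Cons Cons.prems)
  then show ?case by (simp only: append_Cons tag_sum.simps signed_add)
qed

lemma gauge_scale_simp [simp]: "gauge_scale sX sP c (x, p) = (sX c x, sP c p)"
  by (simp add: gauge_scale_def)

lemma module_gauge_scale:
  assumes "module sX" "module sP"
  shows "module (gauge_scale sX sP)"
proof -
  interpret X: module sX by fact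
  interpret P: module sP by fact
  show ?thesis
    by unfold_locales
      (auto simp: gauge_scale_def X.scale_right_distrib P.scale_right_distrib
        X.scale_left_distrib P.scale_left_distrib)
qed

lemma tag_sum_module_hom:
  assumes "module s" "module t" "\<And>a. module_hom s t (\<lambda>x. G x a)"
  shows "module_hom s t (\<lambda>x. tag_sum vs (G x))"
  using assms(3)
proof (induction vs arbitrary: G)
  case (Cons v vs)
  show ?case unfolding tag_sum.simps by (intro hom_plus Cons.IH Cons.prems)
qed simp

lemma letter_linear_tag_sum:
  assumes f: "tag_linear sX sP t f" and sX: "module sX" and sP: "module sP"
  shows "letter_linear (gauge_scale sX sP) t (\<lambda>x. x) (\<lambda>vs. tag_sum vs f)"
proof -
  have t: "module t" using f by (auto simp: tag_linear_def letter_linear_def module_hom_iff)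
  have fst: "module_hom (gauge_scale sX sP) sX fst"
    and snd: "module_hom (gauge_scale sX sP) sP snd"
    using module_gauge_scale[OF sX sP] sX sP by (auto simp: module_hom_iff gauge_scale_def)
  have "module_hom (gauge_scale sX sP) t (\<lambda>v. tag_sum (us @ v # vs) f)" for us vs
    using f
  proof (induction us arbitrary: f)
    case Nil
    have "module_hom sX t (\<lambda>x. f (Inl x # a))" "module_hom sP t (\<lambda>x. f (Inr x # a))" for a
      using Nil letter_linearD[of _ _ Inl f "[]" a] letter_linearD[of _ _ Inr f "[]" a]
      by (auto simp: tag_linear_def)
    from hom_compose[OF fst this(1)] hom_compose[OF snd this(2)]
    show ?case unfolding append_Nil tag_sum.simps
      by (intro hom_plus tag_sum_module_hom module_gauge_scale sX sP t)
  next
    case (Cons z us)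
    show ?case unfolding append_Cons tag_sum.simps
        by (intro hom_plus Cons.IH tag_linear_Cons Cons.prems)
  qed
  then show ?thesis by (simp add: letter_linear_def)
qed

lemma module_hom_untag:
  assumes "module sX" "module sP"
  shows "module_hom sX (gauge_scale sX sP) (\<lambda>x. untag (Inl x))"
    "module_hom sP (gauge_scale sX sP) (\<lambda>x. untag (Inr x))"
  using assms module_gauge_scale[OF assms]
  by (auto simp: module_hom_iff module.scale_zero_right)

lemma tag_linear_untag:
  assumes "letter_linear (gauge_scale sX sP) t (\<lambda>x. x) G" "module sX" "module sP"
  shows "tag_linear sX sP t (\<lambda>ts. G (map untag ts))"
  unfolding tag_linear_def letter_linear_def
  using hom_compose[OF module_hom_untag(1)[OF assms(2,3)] letter_linearD[OF assms(1)]]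
    hom_compose[OF module_hom_untag(2)[OF assms(2,3)] letter_linearD[OF assms(1)]]
  by simp

lemma letter_linear_eq_tag_sum:
  assumes "letter_linear (gauge_scale sX sP) t (\<lambda>x. x) G"
  shows "G vs = tag_sum vs (\<lambda>ts. G (map untag ts))"
  using assms
proof (induction vs arbitrary: G)
  case (Cons v vs)
  have "v = untag (Inl (fst v)) + untag (Inr (snd v))" by (simp add: plus_prod_def)
  then have "G (v # vs) = G ((untag (Inl (fst v)) + untag (Inr (snd v))) # vs)" by (simp only:)
  also have "\<dots> = G (untag (Inl (fst v)) # vs) + G (untag (Inr (snd v)) # vs)"
    using letter_linearD[OF Cons.prems, of "[]" vs] unfolding append_Nil module_hom_iff by blast
  finally have "G (v # vs) = G (untag (Inl (fst v)) # vs) + G (untag (Inr (snd v)) # vs)" .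
  moreover have "G (untag z # vs) = tag_sum vs (\<lambda>ts. G (untag z # map untag ts))" for z
    by (rule Cons.IH[OF letter_linear_Cons[OF Cons.prems]])
  ultimately show ?case by (simp only: tag_sum.simps list.map)
qed simp

text \<open>
  A linear map on the symmetric coalgebra is determined by a function of tagged words, and
  \<open>sym_homI_tagged\<close> says which functions occur.
\<close>

lemma sym_hom_tagged:
  assumes "\<psi> \<in> sym_hom (gauge_scale sX sP) gauge_degrees t" "module sX" "module sP"
  shows "tag_linear sX sP t (\<lambda>ts. \<psi> (wedge (map untag ts)))"
    and "graded_symmetric isl (\<lambda>ts. \<psi> (wedge (map untag ts)))"
    and "\<psi> (wedge vs) = tag_sum vs (\<lambda>ts. \<psi> (wedge (map untag ts)))"
proof -
  note m = sym_hom_letter_linear[OF assms(1) module_gauge_scale[OF assms(2,3)]]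
  show "tag_linear sX sP t (\<lambda>ts. \<psi> (wedge (map untag ts)))"
    by (rule tag_linear_untag[OF m assms(2,3)])
  show "\<psi> (wedge vs) = tag_sum vs (\<lambda>ts. \<psi> (wedge (map untag ts)))"
    by (rule letter_linear_eq_tag_sum[OF m])
  show "graded_symmetric isl (\<lambda>ts. \<psi> (wedge (map untag ts)))"
  proof (rule graded_symmetricI)
    fix us x y vs
    have deg: "untag z \<in> gauge_degrees (if isl z then - 1 else 0)" for z :: "'a + 'b"
      by (cases z) (auto simp: desuspension_def gauge_grading_def)
    show "\<psi> (wedge (map untag (us @ x # y # vs))) =
        signed (isl x \<and> isl y) (\<psi> (wedge (map untag (us @ y # x # vs))))"
      using sym_hom_swap[OF assms(1) deg deg, of "map untag us" x y "map untag vs"]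
      by (simp split: if_splits)
  qed
qed

lemma sym_homI_tagged:
  fixes sX :: "'r::comm_ring_1 \<Rightarrow> 'x::ab_group_add \<Rightarrow> 'x"
    and sP :: "'r \<Rightarrow> 'p::ab_group_add \<Rightarrow> 'p"
  assumes "module_hom wscale t F" "tag_linear sX sP t f" "graded_symmetric isl f"
      "\<And>vs. F (wedge vs) = tag_sum vs f"
    and "module sX" "module sP"
  shows "F \<in> sym_hom (gauge_scale sX sP) gauge_degrees t"
proof (rule sym_homI[OF assms(1)])
  show "letter_linear (gauge_scale sX sP) t (\<lambda>x. x) (\<lambda>xs. F (wedge xs))"
    unfolding assms(4) by (rule letter_linear_tag_sum) fact+
  fix us vs and x y :: "'x \<times> 'p" and i j
  assume "x \<in> gauge_degrees i" "y \<in> gauge_degrees j"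
  then obtain a b where "x = untag a" "isl a = odd i" "y = untag b" "isl b = odd j"
    by (metis homogeneous_untag)
  then show "F (wedge (us @ x # y # vs)) = signed (odd i \<and> odd j) (F (wedge (us @ y # x # vs)))"
    unfolding assms(4) using tag_sum_swap[OF assms(2,3), of us a b vs] by simp
qed

primrec lefts :: "('x + 'p) list \<Rightarrow> 'x list" where
  "lefts [] = []"
| "lefts (t # ts) = (case t of Inl x \<Rightarrow> x # lefts ts | Inr _ \<Rightarrow> lefts ts)"

primrec rights :: "('x + 'p) list \<Rightarrow> 'p list" where
  "rights [] = []"
| "rights (t # ts) = (case t of Inl _ \<Rightarrow> rights ts | Inr p \<Rightarrow> p # rights ts)"

lemma lefts_append [simp]: "lefts (us @ ts) = lefts us @ lefts ts"
  and rights_append [simp]: "rights (us @ ts) = rights us @ rights ts"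
  and lefts_map [simp]: "lefts (map Inl xs) = xs" "lefts (map Inr ps) = []"
  and rights_map [simp]: "rights (map Inl xs) = []" "rights (map Inr ps) = ps"
  by (induction us) (auto split: sum.split, (induction xs, auto), (induction ps, auto),
      (induction xs, auto), (induction ps, auto))

lemma word_parity_isl: "word_parity isl ts = odd (length (lefts ts))"
  by (induction ts) (auto split: sum.split)

text \<open>
  Fields have degree zero, so they can be moved behind the parameters without a sign.
\<close>

lemma graded_symmetric_sort:
  assumes "graded_symmetric isl f"
  shows "f ts = f (map Inl (lefts ts) @ map Inr (rights ts))"
proof -
  have move: "f (us @ Inr p # map Inl xs @ vs) = f (us @ map Inl xs @ Inr p # vs)" for us p xs vs
  proof (induction xs arbitrary: us)
    case (Cons x xs)
    have "f (us @ Inr p # Inl x # map Inl xs @ vs) = f ((us @ [Inl x]) @ Inr p # map Inl xs @ vs)"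
      using graded_symmetricD[OF assms, of us "Inr p" "Inl x" "map Inl xs @ vs"] by simp
    also have "\<dots> = f ((us @ [Inl x]) @ map Inl xs @ Inr p # vs)" by (rule Cons.IH)
    finally show ?case by simp
  qed simp
  have "f (us @ ts) = f (us @ map Inl (lefts ts) @ map Inr (rights ts))" for us
  proof (induction ts arbitrary: us)
    case (Cons t ts)
    have "f (us @ t # ts) = f ((us @ [t]) @ ts)" by simp
    also have "\<dots> = f ((us @ [t]) @ map Inl (lefts ts) @ map Inr (rights ts))" by (rule Cons.IH)
    also have "\<dots> = f (us @ map Inl (lefts (t # ts)) @ map Inr (rights (t # ts)))"
      by (cases t) (simp_all add: move)
    finally show ?case .
  qed simp
  from this[of "[]"] show ?thesis by (simp only: append_Nil)
qed

text \<open>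
  For a sorted word the comultiplication splits parameters and fields independently; only the
  parameters contribute signs.
\<close>

lemma unshuffle_sum_sorted:
  fixes xs :: "'x list" and ps :: "'p list"
  shows "unshuffle_sum isl (map Inl xs @ map Inr ps) F
      = unshuffle_sum (\<lambda>_. True) xs (\<lambda>a b. unshuffle_sum even_letters ps (\<lambda>c e.
     F (map Inl a @ map Inr c) (map Inl b @ map Inr e)))"
proof (induction xs arbitrary: F)
  case Nil
  show ?case by (simp add: unshuffle_sum_map o_def)
next
  case (Cons x xs)
  have "word_parity isl (map Inl a :: ('x + 'p) list) = word_parity (\<lambda>_. True) a"
    "\<not> word_parity isl (map Inr c :: ('x + 'p) list)"
    for a :: "'x list" and c :: "'p list"
    by (simp_all add: word_parity_isl) (simp add: word_parity_def)
  then show ?case by (simp add: Cons.IH unshuffle_sum_signed)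
qed

section \<open>Insertion of a tagged operation\<close>

text \<open>
  An operation with tagged values cannot be linear, since the sum type is not a module. Its values
  enter a word function only through their images in the direct sum, on which that function is
  linear, and this lemma makes the dependence explicit.
\<close>

lemma head_as_tag_sum:
  assumes "tag_linear sX sP t f" "module sX" "module sP"
  shows "module_hom (gauge_scale sX sP) t (\<lambda>v. tag_sum (v # map untag b) f)"
    and "f (z # b) = tag_sum (untag z # map untag b) f"
proof -
  show "module_hom (gauge_scale sX sP) t (\<lambda>v. tag_sum (v # map untag b) f)"
    using letter_linearD[OF letter_linear_tag_sum[OF assms], where us="[]"] by simp
  show "f (z # b) = tag_sum (untag z # map untag b) f"
    using tag_sum_untag[OF assms(1), of "z # b"] by simp
qed

lemma graded_symmetric_insertion_tagged:
  assumes f: "tag_linear sX sP t f" "graded_symmetric isl f"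
      and g: "graded_symmetric isl (\<lambda>ts. untag (g ts))"
    and "module sX" "module sP"
  shows "graded_symmetric isl (insertion isl f g)"
  unfolding insertion_def
proof (rule graded_symmetric_unshuffle_sum)
  show "graded_symmetric isl (\<lambda>b. f (g a # b))" for a by (rule graded_symmetric_Cons[OF f(2)])
  show "graded_symmetric isl (\<lambda>a. f (g a # b))" for b
  proof (rule graded_symmetricI)
    fix us x y vs
    show "f (g (us @ x # y # vs) # b) = signed (isl x \<and> isl y) (f (g (us @ y # x # vs) # b))"
      unfolding head_as_tag_sum(2)[OF f(1) assms(4,5)] graded_symmetricD[OF g, of us x y vs]
      by (rule hom_signed[OF head_as_tag_sum(1)[OF f(1) assms(4,5)]])
  qed
qed

lemma letter_linear_comp:
  assumes "letter_linear s t j f" "module_hom t u h"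
  shows "letter_linear s u j (\<lambda>a. h (f a))"
  unfolding letter_linear_def by (intro allI hom_compose[OF letter_linearD[OF assms(1)] assms(2)])

lemma tag_linear_insertion:
  assumes f: "tag_linear sX sP t f"
    and g: "tag_linear sX sP (gauge_scale sX sP) (\<lambda>ts. untag (g ts))"
    and "module sX" "module sP"
  shows "tag_linear sX sP t (insertion isl f g)"
proof -
  note h = head_as_tag_sum[OF f assms(3,4)]
  have "tag_linear sX sP t (\<lambda>a. f (g a # b))" for b
    unfolding tag_linear_def h(2)
    using letter_linear_comp[OF conjunct1[OF g[unfolded tag_linear_def]] h(1)]
      letter_linear_comp[OF conjunct2[OF g[unfolded tag_linear_def]] h(1)] by blast
  then have left: "letter_linear sX t Inl (\<lambda>a. f (g a # b))"
      "letter_linear sP t Inr (\<lambda>a. f (g a # b))" for b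
    by (simp_all add: tag_linear_def)
  have right: "letter_linear sX t Inl (\<lambda>b. f (g a # b))"
      "letter_linear sP t Inr (\<lambda>b. f (g a # b))" for a
    using tag_linear_Cons[OF f, of "g a"] by (simp_all add: tag_linear_def)
  show ?thesis
    unfolding tag_linear_def insertion_def
    using letter_linear_unshuffle_sum[where q=True, OF left(1) right(1)]
      letter_linear_unshuffle_sum[where q=False, OF left(2) right(2)] by simp
qed

lemma letter_linear_sum:
  assumes "letter_linear s t j f" "letter_linear s t j g"
  shows "letter_linear s t j (\<lambda>a. f a + g a)"
  unfolding letter_linear_def by (intro allI hom_plus letter_linearD assms)

lemma graded_symmetric_sum:
  assumes "graded_symmetric par f" "graded_symmetric par g"
  shows "graded_symmetric par (\<lambda>a. f a + g a)"
  using assms unfolding graded_symmetric_def by (metis signed_add)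

lemma graded_symmetric_even_comp: "graded_symmetric even_letters f
    \<Longrightarrow> graded_symmetric even_letters (\<lambda>a. h (f a))"
  unfolding graded_symmetric_def by simp

section \<open>The gauge operation and its square\<close>

text \<open>
  The data of the theorem on words: \<open>d\<close> is the gauge action and \<open>c\<close> the structure function of the
  closure relation \<open>closes\<close>.
\<close>

locale gauge_words =
  fixes kX :: "'k::field_char_0 \<Rightarrow> 'x::ab_group_add \<Rightarrow> 'x"
    and kP :: "'k \<Rightarrow> 'p::ab_group_add \<Rightarrow> 'p"
    and d :: "'x \<Rightarrow> 'p list \<Rightarrow> 'p"
    and c :: "'x \<Rightarrow> 'x \<Rightarrow> 'p list \<Rightarrow> 'x"
  assumes module_X: "module kX" and module_P: "module kP"
    and d_hom: "\<And>w. module_hom kX kP (\<lambda>\<xi>. d \<xi> w)"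
    and d_letter_linear: "\<And>\<xi>. letter_linear kP kP (\<lambda>x. x) (d \<xi>)"
    and d_graded_symmetric: "\<And>\<xi>. graded_symmetric even_letters (d \<xi>)"
    and c_hom_left: "\<And>\<eta> w. module_hom kX kX (\<lambda>\<xi>. c \<xi> \<eta> w)"
    and c_hom_right: "\<And>\<xi> w. module_hom kX kX (\<lambda>\<eta>. c \<xi> \<eta> w)"
    and c_letter_linear: "\<And>\<xi> \<eta>. letter_linear kP kX (\<lambda>x. x) (c \<xi> \<eta>)"
    and c_graded_symmetric: "\<And>\<xi> \<eta>. graded_symmetric even_letters (c \<xi> \<eta>)"
    and closes: "\<And>\<xi> \<eta> w. commutator (d \<xi>) (d \<eta>) w = hat_words d (c \<xi> \<eta>) w"
    and hat_injective: "\<And>\<pi> w. letter_linear kP kX (\<lambda>x. x) \<pi> \<Longrightarrow> graded_symmetric even_letters \<pi> \<Longrightarrow>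
      (\<And>w. hat_words d \<pi> w = 0) \<Longrightarrow> \<pi> w = 0"
begin

lemma d_add: "d (\<xi> + \<eta>) w = d \<xi> w + d \<eta> w"
  using d_hom by (simp add: module_hom_iff)

lemma d_head: "head_additive (d \<xi>)"
  using letter_linearD[OF d_letter_linear, where us="[]"]
      by (simp add: head_additive_def module_hom_iff)

text \<open>
  The commutator is antisymmetric, and \<open>c\<close> is determined by its extension. Without antisymmetry of
  \<open>c\<close> there would be no graded symmetric map with the prescribed values.
\<close>

lemma c_antisym: "c \<xi> \<eta> w = - c \<eta> \<xi> w"
proof -
  have "(\<lambda>w. c \<xi> \<eta> w + c \<eta> \<xi> w) w = 0"
  proof (rule hat_injective)
    show "letter_linear kP kX (\<lambda>x. x) (\<lambda>w. c \<xi> \<eta> w + c \<eta> \<xi> w)"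
      by (intro letter_linear_sum c_letter_linear)
    show "graded_symmetric even_letters (\<lambda>w. c \<xi> \<eta> w + c \<eta> \<xi> w)"
      by (intro graded_symmetric_sum c_graded_symmetric)
    fix w
    have "hat_words d (\<lambda>w. c \<xi> \<eta> w + c \<eta> \<xi> w) w = hat_words d (c \<xi> \<eta>) w + hat_words d (c \<eta> \<xi>) w"
      by (simp add: hat_words_def d_add unshuffle_sum_add)
    also have "\<dots> = 0" unfolding closes[symmetric] by (simp add: commutator_def)
    finally show "hat_words d (\<lambda>w. c \<xi> \<eta> w + c \<eta> \<xi> w) w = 0" .
  qed
  then show ?thesis by (simp add: eq_neg_iff_add_eq_0)
qed

lemma parameter_bracket_letter_linear: "letter_linear kP kX (\<lambda>x. x)
    (parameter_bracket d c (c \<xi> \<eta>) \<zeta>)"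
proof -
  have "letter_linear kP kX (\<lambda>x. x) (\<lambda>a. c \<xi> \<eta> (d \<zeta> a # b))" for b
    using letter_linear_comp[OF d_letter_linear letter_linearD[OF c_letter_linear, where us="[]"]]
        by simp
  then have "letter_linear kP kX (\<lambda>x. x)
      (\<lambda>xs. unshuffle_sum even_letters xs (\<lambda>a b. c \<xi> \<eta> (d \<zeta> a # b)))"
    by (rule letter_linear_unshuffle_sum[where q=False])
        (simp_all add: letter_linear_Cons c_letter_linear)
  moreover have "letter_linear kP kX (\<lambda>x. x)
      (\<lambda>xs. unshuffle_sum even_letters xs (\<lambda>a b. c (c \<xi> \<eta> a) \<zeta> b))"
    by (intro letter_linear_unshuffle_sum[where q=False] c_letter_linear
        letter_linear_comp[OF c_letter_linear] c_hom_left) simp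
  ultimately show ?thesis
    using letter_linear_sum unfolding parameter_bracket_def[abs_def] insertion_def by blast
qed

lemma parameter_bracket_graded_symmetric: "graded_symmetric even_letters
    (parameter_bracket d c (c \<xi> \<eta>) \<zeta>)"
  unfolding parameter_bracket_def[abs_def] insertion_def
proof (intro graded_symmetric_sum graded_symmetric_unshuffle_sum)
  show "graded_symmetric even_letters (\<lambda>a. c \<xi> \<eta> (d \<zeta> a # b))" for b
    using graded_symmetric_even_comp[OF d_graded_symmetric] .
  show "graded_symmetric even_letters (\<lambda>b. c \<xi> \<eta> (d \<zeta> a # b))" for a
    by (intro graded_symmetric_Cons c_graded_symmetric)
  show "graded_symmetric even_letters (\<lambda>a. c (c \<xi> \<eta> a) \<zeta> b)" for b
    using graded_symmetric_even_comp[OF c_graded_symmetric] .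
  show "graded_symmetric even_letters (\<lambda>b. c (c \<xi> \<eta> a) \<zeta> b)" for a
    by (rule c_graded_symmetric)
qed

text \<open>
  The Jacobi identity in the Lie algebra of field dependent parameters, pulled back along the
  injective extension.
\<close>

lemma jacobi: "parameter_bracket d c (c \<xi>1 \<xi>2) \<xi>3 w + parameter_bracket d c (c \<xi>2 \<xi>3) \<xi>1 w
    + parameter_bracket d c (c \<xi>3 \<xi>1) \<xi>2 w = 0" (is "?J w = 0")
proof (rule hat_injective[of ?J])
  show "letter_linear kP kX (\<lambda>x. x) ?J" by (intro letter_linear_sum parameter_bracket_letter_linear)
  show "graded_symmetric even_letters ?J"
      by (intro graded_symmetric_sum parameter_bracket_graded_symmetric)
  show "hat_words d ?J w = 0" for w
    by (rule hat_cyclic_sum[OF d_add d_head d_graded_symmetric closes])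
qed

text \<open>
  The value on a sorted word. Where it vanishes, the zero is tagged so that the operation has odd
  degree on all words.
\<close>

definition gauge_value :: "'x list \<Rightarrow> 'p list \<Rightarrow> 'x + 'p" where
  "gauge_value \<xi>s \<phi>s = (case \<xi>s of [] \<Rightarrow> Inl 0 | [\<xi>] \<Rightarrow> Inr (d \<xi> \<phi>s) | [\<xi>, \<eta>] \<Rightarrow> Inl (c \<xi> \<eta> \<phi>s)
     | _ \<Rightarrow> if odd (length \<xi>s) then Inr 0 else Inl 0)"

definition gauge_letter :: "('x + 'p) list \<Rightarrow> 'x + 'p" where
  "gauge_letter ts = gauge_value (lefts ts) (rights ts)"

abbreviation "kL \<equiv> gauge_scale kX kP"

lemma module_L: "module kL" by (rule module_gauge_scale[OF module_X module_P])

lemma gauge_value_simps [simp]: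
  "gauge_value [] \<phi>s = Inl 0" "gauge_value [\<xi>] \<phi>s = Inr (d \<xi> \<phi>s)"
  "gauge_value [\<xi>, \<eta>] \<phi>s = Inl (c \<xi> \<eta> \<phi>s)"
  by (simp_all add: gauge_value_def)

lemma pair_zero [simp]: "(0 :: 'x, 0 :: 'p) = 0"
  by (simp add: zero_prod_def)

lemma pair_eq_zero [simp]: "(\<xi> :: 'x, \<phi> :: 'p) = 0 \<longleftrightarrow> \<xi> = 0 \<and> \<phi> = 0"
  by (simp add: zero_prod_def del: pair_zero)

lemma untag_zero [simp]: "untag (Inl 0 :: 'x + 'p) = 0" "untag (Inr 0 :: 'x + 'p) = 0"
  by simp_all

lemma untag_gauge_value_long: "length \<xi>s > 2 \<Longrightarrow> untag (gauge_value \<xi>s \<phi>s) = 0"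
  by (auto simp: gauge_value_def split: list.split)

lemma isl_gauge_letter: "isl (gauge_letter ts) = (word_parity isl ts \<noteq> True)"
  by (auto simp: gauge_letter_def gauge_value_def word_parity_isl split: list.split)

lemma gauge_value_hom_right:
  "module_hom kP kL (\<lambda>p. untag (gauge_value \<xi>s (us @ p # vs)))"
proof -
  have z: "module_hom kP kL (\<lambda>p. 0)" by (rule hom_zero[OF module_P module_L])
  consider "\<xi>s = []" | \<xi> where "\<xi>s = [\<xi>]" | \<xi> \<eta> where "\<xi>s = [\<xi>, \<eta>]" | "length \<xi>s > 2"
    by (cases \<xi>s; cases "tl \<xi>s"; cases "tl (tl \<xi>s)") auto
  then show ?thesis
  proof cases
    case 1 then show ?thesis using z by simp
  next
    case (2 \<xi>)
    then show ?thesis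
      using hom_compose[OF letter_linearD[OF d_letter_linear]
          module_hom_untag(2)[OF module_X module_P]] by simp
  next
    case (3 \<xi> \<eta>)
    then show ?thesis
      using hom_compose[OF letter_linearD[OF c_letter_linear]
          module_hom_untag(1)[OF module_X module_P]] by simp
  next
    case 4 then show ?thesis using z by (simp add: untag_gauge_value_long)
  qed
qed

lemma gauge_value_hom_left:
  "module_hom kX kL (\<lambda>\<xi>. untag (gauge_value (us @ \<xi> # vs) \<phi>s))"
proof -
  have z: "module_hom kX kL (\<lambda>p. 0)" by (rule hom_zero[OF module_X module_L])
  consider "us = []" "vs = []" | b where "us = []" "vs = [b]" | a where "us = [a]" "vs = []"
    | "length us + length vs > 1"
    by (cases us; cases vs; cases "tl us"; cases "tl vs") auto
  then show ?thesis
  proof cases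
    case 1
    then show ?thesis
      using hom_compose[OF d_hom module_hom_untag(2)[OF module_X module_P]] by simp
  next
    case (2 b)
    then show ?thesis
      using hom_compose[OF c_hom_left module_hom_untag(1)[OF module_X module_P]] by simp
  next
    case (3 a)
    then show ?thesis
      using hom_compose[OF c_hom_right module_hom_untag(1)[OF module_X module_P]] by simp
  next
    case 4 then show ?thesis using z by (simp add: untag_gauge_value_long)
  qed
qed

lemma gauge_letter_tag_linear: "tag_linear kX kP kL (\<lambda>ts. untag (gauge_letter ts))"
  using gauge_value_hom_left gauge_value_hom_right
  by (auto simp: tag_linear_def letter_linear_def gauge_letter_def)

text \<open>
  Symmetry in the fields is inherited from \<open>d\<close> and \<open>c\<close>; the sign for two parameters is the
  antisymmetry of \<open>c\<close>.
\<close>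

lemma gauge_letter_graded_symmetric: "graded_symmetric isl (\<lambda>ts. untag (gauge_letter ts))"
proof (rule graded_symmetricI)
  fix us x y vs
  have right: "gauge_value \<xi>s (as @ p # q # bs) = gauge_value \<xi>s (as @ q # p # bs)" for \<xi>s as p q bs
    unfolding gauge_value_def
    using graded_symmetricD[OF d_graded_symmetric, of _ as p q bs]
        graded_symmetricD[OF c_graded_symmetric, of _ _ as p q bs]
    by (simp split: list.split)
  have left: "untag (gauge_value (as @ \<xi> # \<eta> # bs) \<phi>s) = - untag (gauge_value (as @ \<eta> # \<xi> # bs) \<phi>s)"
    for as bs \<xi> \<eta> \<phi>s
  proof (cases "as = [] \<and> bs = []")
    case True
    then show ?thesis using c_antisym[of \<xi> \<eta> \<phi>s] by (simp add: uminus_prod_def)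
  next
    case False
    then have "length (as @ \<xi> # \<eta> # bs) > 2" "length (as @ \<eta> # \<xi> # bs) > 2"
      by (auto simp: neq_Nil_conv)
    then show ?thesis by (simp only: untag_gauge_value_long neg_0_equal_iff_equal)
  qed
  show "untag (gauge_letter (us @ x # y # vs)) =
      signed (isl x \<and> isl y) (untag (gauge_letter (us @ y # x # vs)))"
  proof (cases x)
    case x: (Inl \<xi>)
    show ?thesis
    proof (cases y)
      case (Inl \<eta>)
      then show ?thesis
        using left[of "lefts us" \<xi> \<eta> "lefts vs" "rights us @ rights vs"] x
        by (simp add: gauge_letter_def signed_def)
    qed (use x in \<open>simp add: gauge_letter_def\<close>)
  next
    case x: (Inr \<phi>)
    show ?thesis
    proof (cases y)
      case (Inr \<psi>)
      then show ?thesis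
        using right[of "lefts us @ lefts vs" "rights us" \<phi> \<psi> "rights vs"] x
        by (simp add: gauge_letter_def)
    qed (use x in \<open>simp add: gauge_letter_def\<close>)
  qed
qed

lemma gauge_value_head_zero: "untag (gauge_value (0 # \<xi>s) \<phi>s)
    = 0" "untag (gauge_value \<xi>s (0 # \<phi>s)) = 0"
  using hom_at_zero[OF gauge_value_hom_left, of "[]"]
      hom_at_zero[OF gauge_value_hom_right, of _ "[]"]
  by simp_all

lemma untag_unshuffle_sum:
  "unshuffle_sum par xs (\<lambda>a b. untag (Inl (F a b))) = untag (Inl (unshuffle_sum par xs F))"
  "unshuffle_sum par xs (\<lambda>a b. untag (Inr (G a b))) = untag (Inr (unshuffle_sum par xs G))"
  by (rule unshuffle_sum_hom[symmetric, where H="\<lambda>x. untag (Inl x)"]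
      unshuffle_sum_hom[symmetric, where H="\<lambda>x. untag (Inr x)"];
    simp)+

text \<open>
  The composite of the operation with its own coderivation vanishes. It is graded symmetric, so
  sorted words suffice, and the number of parameters decides. Two parameters give the closure
  relation, three give the Jacobi identity, and for any other number each term vanishes
  separately.
\<close>

lemma gauge_letter_square: "unshuffle_sum isl ts (\<lambda>a b. untag (gauge_letter (gauge_letter a # b)))
    = (0 :: 'x \<times> 'p)"
proof -
  define W where "W ts = unshuffle_sum isl ts
      (\<lambda>a b. untag (gauge_letter (gauge_letter a # b)) :: 'x \<times> 'p)" for ts
  define \<xi>s where "\<xi>s = lefts ts"
  define \<phi>s where "\<phi>s = rights ts"
  have "graded_symmetric isl W"
    unfolding W_def[abs_def]
    using graded_symmetric_insertion_tagged[OF gauge_letter_tag_linear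
        gauge_letter_graded_symmetric gauge_letter_graded_symmetric module_X module_P]
    unfolding insertion_def .
  then have sorted: "W ts = W (map Inl \<xi>s @ map Inr \<phi>s)"
    unfolding \<xi>s_def \<phi>s_def by (rule graded_symmetric_sort)
  \<comment> \<open>\<open>Z a b\<close> collects the terms in which the first application consumes the parameters \<open>a\<close>.\<close>
  define Z :: "'x list \<Rightarrow> 'x list \<Rightarrow> 'x \<times> 'p" where "Z a b
      = unshuffle_sum even_letters \<phi>s (\<lambda>p q. untag (case gauge_value a p of
      Inl \<xi> \<Rightarrow> gauge_value (\<xi> # b) q | Inr \<phi> \<Rightarrow> gauge_value b (\<phi> # q)))" for a b
  have W: "W (map Inl \<xi>s @ map Inr \<phi>s) = unshuffle_sum (\<lambda>_. True) \<xi>s Z"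
  proof -
    have "untag (gauge_letter (gauge_letter (map Inl a @ map Inr p) # map Inl b @ map Inr q)) =
      (untag (case gauge_value a p of
      Inl \<xi> \<Rightarrow> gauge_value (\<xi> # b) q | Inr \<phi> \<Rightarrow> gauge_value b (\<phi> # q)) :: 'x \<times> 'p)" for a b p q
      by (simp add: gauge_letter_def split: sum.split)
    then show ?thesis unfolding W_def unshuffle_sum_sorted Z_def by simp
  qed
  \<comment> \<open>Applied to fields alone, or to more than two parameters, the operation yields a zero letter.\<close>
  have Z0: "Z [] b = 0" for b by (simp add: Z_def gauge_value_head_zero)
  have Z1: "Z [\<xi>] [] = 0" "Z [\<xi>] [\<eta>] = untag (Inr (insertion even_letters (d \<eta>) (d \<xi>) \<phi>s))"
    "Z [\<xi>] [\<eta>, \<zeta>] = untag (Inl (insertion even_letters (c \<eta> \<zeta>) (d \<xi>) \<phi>s))" for \<xi> \<eta> \<zeta>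
    by (simp_all only: Z_def gauge_value_simps sum.case untag_unshuffle_sum insertion_def
        untag_zero unshuffle_sum_zero)
  have Z2: "Z [\<xi>, \<eta>] [] = untag (Inr (hat_words d (c \<xi> \<eta>) \<phi>s))"
    "Z [\<xi>, \<eta>] [\<zeta>] = untag (Inl (unshuffle_sum even_letters \<phi>s (\<lambda>a b. c (c \<xi> \<eta> a) \<zeta> b)))" for \<xi> \<eta> \<zeta>
    by (simp_all only: Z_def gauge_value_simps sum.case untag_unshuffle_sum hat_words_def)
  have Z3: "Z a b = 0" if "length a > 2" for a b
  proof -
    have "untag (case gauge_value a p of
      Inl \<xi> \<Rightarrow> gauge_value (\<xi> # b) q | Inr \<phi> \<Rightarrow> gauge_value b (\<phi> # q)) = (0 :: 'x \<times> 'p)" for p q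
      using untag_gauge_value_long[OF that, of p] gauge_value_head_zero(1)[of b q]
          gauge_value_head_zero(2)[of b q]
      by (cases "gauge_value a p") auto
    then show ?thesis by (simp add: Z_def)
  qed
  \<comment> \<open>If the first application consumes one or two of at least four parameters, the second finds at
      least three of them, counting one that the first may have produced.\<close>
  have Zb: "Z a b = 0" if "length a + length b > 3" for a b
  proof -
    have "untag (case gauge_value a p of
      Inl \<xi> \<Rightarrow> gauge_value (\<xi> # b) q | Inr \<phi> \<Rightarrow> gauge_value b (\<phi> # q)) = (0 :: 'x \<times> 'p)"
      if "a \<noteq> []" "\<not> length a > 2" for p q
      using that \<open>length a + length b > 3\<close>
      by (cases a; cases "tl a") (auto simp: untag_gauge_value_long)
    then show ?thesis using Z0[of b] Z3[of a b]
        by (cases "a = []"; cases "length a > 2") (auto simp: Z_def)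
  qed
  have "unshuffle_sum (\<lambda>_. True) \<xi>s Z = 0"
  proof -
    consider "\<xi>s = []" | \<xi> where "\<xi>s = [\<xi>]" | \<xi> \<eta> where "\<xi>s = [\<xi>, \<eta>]"
      | \<xi> \<eta> \<zeta> where "\<xi>s = [\<xi>, \<eta>, \<zeta>]" | "length \<xi>s > 3"
      by (cases \<xi>s; cases "tl \<xi>s"; cases "tl (tl \<xi>s)"; cases "tl (tl (tl \<xi>s))") auto
    then show ?thesis
    proof cases
      case 1 then show ?thesis by (simp add: Z0)
    next
      case (2 \<xi>) then show ?thesis by (simp add: Z0 Z1)
    next
      case (3 \<xi> \<eta>)
      then show ?thesis
        using closes[of \<xi> \<eta> \<phi>s, symmetric]
        by (simp add: Z0 Z1 Z2 signed_def commutator_def)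
    next
      case (4 \<xi> \<eta> \<zeta>)
      \<comment> \<open>The middle term of the expansion carries a minus sign; antisymmetry makes the sum cyclic.\<close>
      have neg: "unshuffle_sum even_letters \<phi>s (\<lambda>a b. c (c \<zeta> \<xi> a) \<eta> b) =
          - unshuffle_sum even_letters \<phi>s (\<lambda>a b. c (c \<xi> \<zeta> a) \<eta> b)"
        "insertion even_letters (c \<zeta> \<xi>) (d \<eta>) \<phi>s = - insertion even_letters (c \<xi> \<zeta>) (d \<eta>) \<phi>s"
        using c_antisym[of \<zeta> \<xi>] hom_signed[OF c_hom_left, where c=True]
        by (simp_all add: insertion_def unshuffle_sum_minus signed_def)
      show ?thesis
        using jacobi[of \<xi> \<eta> \<zeta> \<phi>s] 4
        by (simp add: Z0 Z1 Z2 Z3 signed_def parameter_bracket_def neg algebra_simps)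
    next
      case 5
      have "unshuffle_sum (\<lambda>_. True) \<xi>s Z = unshuffle_sum (\<lambda>_. True) \<xi>s (\<lambda>a b. 0)"
      proof (rule unshuffle_sum_mset_cong)
        fix a b assume "mset a + mset b = mset \<xi>s"
        then have "length a + length b = length \<xi>s" by (metis size_mset size_union)
        then show "Z a b = 0" using 5 by (intro Zb) simp
      qed
      then show ?thesis by simp
    qed
  qed
  then show ?thesis using W sorted by (simp add: W_def)
qed

end

section \<open>Coderivations on words\<close>

lemma wscale_sign: "wscale (if b then - 1 else 1) w = signed b w"
  by (rule poly_mapping_eqI) (simp add: signed_def)

lemma coder_word_eq_unshuffle_sum:
  assumes "list_all2 (\<lambda>t n. par t = odd n) ts ds"
  shows "coder_word h ds (map e ts) = unshuffle_sum par ts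
      (\<lambda>a b. wedge (h (wedge (map e a)) # map e b))"
proof -
  have len: "length ds = length ts" using assms by (simp add: list_all2_lengthD)
  have par: "odd (ds ! i) = par (ts ! i)" if "i < length ts" for i
    using list_all2_nthD[OF assms that] by simp
  show ?thesis
    unfolding coder_word_def unshuffle_sum_permutations length_map
  proof (intro sum.cong refl)
    fix p \<sigma> assume "\<sigma> \<in> unshuffles p (length ts)"
    then have \<sigma>: "\<sigma> permutes {..<length ts}" by (simp add: unshuffles_def)
    have lt: "\<sigma> i < length ts" if "i < length ts" for i
      using permutes_in_image[OF \<sigma>, of i] that by simp
    have "{(i, j). i < j \<and> j < length ds \<and> \<sigma> j < \<sigma> i \<and> odd (ds ! \<sigma> i) \<and> odd (ds ! \<sigma> j)}
        = {(i, j). i < j \<and> j < length ts \<and> \<sigma> j < \<sigma> i \<and> par (ts ! \<sigma> i) \<and> par (ts ! \<sigma> j)}"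
    proof -
      have "(odd (ds ! \<sigma> i) \<and> odd (ds ! \<sigma> j)) = (par (ts ! \<sigma> i) \<and> par (ts ! \<sigma> j))"
        if "i < j" "j < length ts" for i j
        using par[OF lt, of i] par[OF lt, of j] that by simp
      then show ?thesis by (auto simp: len)
    qed
    then show "wscale (koszul_sign ds \<sigma>) (wedge (h (wedge (take p (permute_list \<sigma> (map e ts))))
          # drop p (permute_list \<sigma> (map e ts))))
        = signed (odd (card {(i, j). i < j \<and> j < length ts \<and> \<sigma> j < \<sigma> i \<and> par (ts ! \<sigma> i)
            \<and> par (ts ! \<sigma> j)}))
          (wedge (h (wedge (map e (take p (permute_list \<sigma> ts)))) # map e
              (drop p (permute_list \<sigma> ts))))"
      unfolding koszul_sign_eq wscale_sign permute_list_map[OF \<sigma>] take_map drop_map by simp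
  qed
qed

lemma odot_wedge:
  assumes "module_hom wscale t f"
  shows "odot f g (wedge xs) = insertion even_letters (\<lambda>w. f (wedge w)) (\<lambda>w. g (wedge w)) xs"
proof -
  interpret module_hom wscale t f by fact
  have "list_all2 (\<lambda>t n. even_letters t = odd n) xs (replicate (length xs) (0 :: int))"
    by (simp add: list_all2_conv_all_nth)
  from coder_word_eq_unshuffle_sum[OF this, of g "\<lambda>x. x"]
  have "coder g (wedge xs) = unshuffle_sum even_letters xs (\<lambda>a b. wedge (g (wedge a) # b))"
    by (simp add: coder_def extend_wedge[OF module_wscale])
  then show ?thesis by (simp add: odot_def insertion_def unshuffle_sum_hom[where H=f] add)
qed

lemma hat_delta_wedge:
  assumes "module sP"
  shows "hat_delta sP \<delta> \<pi> (wedge xs) = hat_words (\<lambda>\<xi> w. \<delta> \<xi> (wedge w)) (\<lambda>w. \<pi> (wedge w)) xs"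
  by (simp add: hat_delta_def extend_wedge[OF assms] hat_words_def unshuffle_sum_permutations)

lemma sym_hom_deg0_graded_symmetric:
  assumes "F \<in> sym_hom s deg0 t"
  shows "graded_symmetric even_letters (\<lambda>w. F (wedge w))"
  by (rule graded_symmetricI) (use sym_hom_swap[OF assms, of _ 0 _ 0] in \<open>simp add: deg0_def\<close>)

text \<open>
  In odd degrees \<open>deg0\<close> contains only zero, so the sign rule imposes nothing beyond symmetry.
\<close>

lemma extend_sym_hom_deg0:
  fixes s :: "'r::comm_ring_1 \<Rightarrow> 'v::ab_group_add \<Rightarrow> 'v"
  assumes "module t" "letter_linear s t (\<lambda>x. x) f" "graded_symmetric even_letters f"
  shows "extend t f \<in> sym_hom s deg0 t"
proof (rule sym_homI[OF extend_hom[OF assms(1)]])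
  show "letter_linear s t (\<lambda>x. x) (\<lambda>w. extend t f (wedge w))"
    using assms(2) by (simp add: extend_wedge[OF assms(1)])
  fix us vs and x y :: 'v and i j
  assume *: "x \<in> deg0 i" "y \<in> deg0 j"
  show "extend t f (wedge (us @ x # y # vs)) = signed (odd i \<and> odd j)
      (extend t f (wedge (us @ y # x # vs)))"
  proof (cases "odd i \<and> odd j")
    case True
    then have "i \<noteq> 0" by auto
    then have "x = 0" using * by (simp add: deg0_def)
    then show ?thesis
      using letter_linear_zero[OF assms(2), of us "y # vs"]
          letter_linear_zero[OF assms(2), of "us @ [y]" vs]
      by (simp add: extend_wedge[OF assms(1)])
  next
    case False
    then show ?thesis
      using graded_symmetricD[OF assms(3), of us x y vs]
          by (auto simp: extend_wedge[OF assms(1)] signed_def)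
  qed
qed

text \<open>
  The degree of a word of nonzero homogeneous letters is minus the number of its parameters.
\<close>

lemma homogeneous_list_untag:
  assumes "homogeneous_list gauge_degrees xs ds"
  obtains ts where "xs = map untag ts" "list_all2 (\<lambda>t n. isl t = odd n) ts ds"
    and "0 \<in> set xs \<or> sum_list ds = - int (length (lefts ts))"
proof -
  have "\<exists>ts. xs = map untag ts \<and> list_all2 (\<lambda>t n. isl t = odd n) ts ds \<and>
      (0 \<in> set xs \<or> sum_list ds = - int (length (lefts ts)))"
    using assms unfolding homogeneous_list_def
  proof (induction xs ds rule: list_all2_induct)
    case (Cons x xs n ds)
    then obtain ts where ts: "xs = map untag ts" "list_all2 (\<lambda>t n. isl t = odd n) ts ds"
      "0 \<in> set xs \<or> sum_list ds = - int (length (lefts ts))" by blast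
    obtain t where t: "x = untag t" "isl t = odd n" using homogeneous_untag[OF Cons.hyps(1)]
        by blast
    have "x = 0 \<or> n = (if isl t then - 1 else 0)"
      using Cons.hyps(1) t
      by (cases t) (auto simp: desuspension_def gauge_grading_def zero_prod_def split: if_splits)
    then show ?case using ts t by (intro exI[of _ "t # ts"]) (cases t; auto)
  qed simp
  then show ?thesis using that by blast
qed

lemma zero_in_gauge_degrees: "0 \<in> gauge_degrees n"
  by (auto simp: desuspension_def gauge_grading_def zero_prod_def)

lemma graded_space_gauge:
  assumes "module kX" "module kP"
  shows "graded_space (gauge_scale kX kP) (gauge_grading :: int
      \<Rightarrow> ('x::ab_group_add \<times> 'p::ab_group_add) set)"
  unfolding graded_space_def
proof (intro conjI allI)
  interpret L: module "gauge_scale kX kP" by (rule module_gauge_scale[OF assms])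
  show "vector_space (gauge_scale kX kP)" using L.module_axioms module_iff_vector_space by blast
  show "module.subspace (gauge_scale kX kP) (gauge_grading n :: ('x \<times> 'p) set)" for n
    using assms by (auto simp: L.subspace_def gauge_grading_def zero_prod_def gauge_scale_def
        module.scale_zero_right)
  fix x :: "'x \<times> 'p"
  have supp: "finite {n. c n \<noteq> 0}" "(\<Sum>n | c n \<noteq> 0. c n) = (fst (c 0), snd (c 1))"
    if c: "\<forall>n. c n \<in> gauge_grading n" for c :: "int \<Rightarrow> 'x \<times> 'p"
  proof -
    have z: "c n = 0" if "n \<notin> {0, 1}" for n
      using c[rule_format, of n] that by (simp add: gauge_grading_def zero_prod_def)
    then have sub: "{n. c n \<noteq> 0} \<subseteq> {0, 1}" by auto
    then show "finite {n. c n \<noteq> 0}" by (rule finite_subset) simp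
    have "(\<Sum>n | c n \<noteq> 0. c n) = (\<Sum>n\<in>{0, 1}. c n)"
      using sub by (intro sum.mono_neutral_left) auto
    also have "\<dots> = (fst (c 0), snd (c 1))"
      using c[rule_format, of 0] c[rule_format, of 1]
      by (auto simp: gauge_grading_def plus_prod_def)
    finally show "(\<Sum>n | c n \<noteq> 0. c n) = (fst (c 0), snd (c 1))" .
  qed
  define c where "c n = (if n = 0 then (fst x, 0) else if n = 1 then (0, snd x) else 0)"
      for n :: int
  have c: "\<forall>n. c n \<in> gauge_grading n" by (simp add: c_def gauge_grading_def zero_prod_def)
  show "\<exists>!c. (\<forall>n. c n \<in> gauge_grading n) \<and> finite {n. c n \<noteq> 0} \<and> x = (\<Sum>n | c n \<noteq> 0. c n)"
  proof (rule ex1I[of _ c])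
    show "(\<forall>n. c n \<in> gauge_grading n) \<and> finite {n. c n \<noteq> 0} \<and> x = (\<Sum>n | c n \<noteq> 0. c n)"
      using c supp[OF c] by (simp add: c_def)
    fix e assume e: "(\<forall>n. e n \<in> gauge_grading n) \<and> finite {n. e n \<noteq> 0} \<and> x = (\<Sum>n | e n \<noteq> 0. e n)"
    then have x: "fst x = fst (e 0)" "snd x = snd (e 1)" using supp(2)[of e] by simp_all
    show "e = c"
    proof
      fix n
      have "e n \<in> gauge_grading n" using e by blast
      then show "e n = c n"
        using x by (cases "e n") (auto simp: c_def gauge_grading_def zero_prod_def split: if_splits)
    qed
  qed
qed

section \<open>The strongly homotopy Lie structure\<close>

context gauge_words
begin

definition gauge_map :: "(('x \<times> 'p) list \<Rightarrow>\<^sub>0 'k) \<Rightarrow> 'x \<times> 'p" where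
  "gauge_map = extend kL (\<lambda>vs. tag_sum vs (\<lambda>ts. untag (gauge_letter ts)))"

definition gauge_coderivation :: "(('x \<times> 'p) list \<Rightarrow>\<^sub>0 'k) \<Rightarrow> (('x \<times> 'p) list \<Rightarrow>\<^sub>0 'k)" where
  "gauge_coderivation = extend wscale (\<lambda>vs. tag_sum vs (\<lambda>ts.
     unshuffle_sum isl ts (\<lambda>a b. wedge (untag (gauge_letter a) # map untag b))))"

lemma gauge_map_untag: "gauge_map (wedge (map untag ts)) = untag (gauge_letter ts)"
  by (simp add: gauge_map_def extend_wedge[OF module_L] tag_sum_untag[OF gauge_letter_tag_linear])

lemma gauge_map_sym_hom: "gauge_map \<in> sym_hom kL gauge_degrees kL"
  unfolding gauge_map_def
  by (rule sym_homI_tagged[OF extend_hom[OF module_L] gauge_letter_tag_linear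
      gauge_letter_graded_symmetric
        extend_wedge[OF module_L] module_X module_P])

text \<open>
  By symmetry and linearity in the letters, a map is determined by its values on sorted words.
\<close>

lemma gauge_map_unique:
  assumes D: "D \<in> sym_hom kL gauge_degrees kL"
    and vals: "\<And>\<xi>s \<phi>s. D (wedge (map untag (map Inl \<xi>s @ map Inr \<phi>s))) = untag (gauge_value \<xi>s \<phi>s)"
  shows "D = gauge_map"
proof (rule hom_eqI[OF sym_hom_hom[OF D] sym_hom_hom[OF gauge_map_sym_hom]])
  fix vs
  note D' = sym_hom_tagged[OF D module_X module_P]
  have "D (wedge (map untag ts)) = untag (gauge_letter ts)" for ts
    using graded_symmetric_sort[OF D'(2), of ts] vals[of "lefts ts" "rights ts"]
    by (simp add: gauge_letter_def)
  then show "D (wedge vs) = gauge_map (wedge vs)"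
    using D'(3)[of vs] by (simp add: gauge_map_def extend_wedge[OF module_L])
qed

lemma gauge_coderivation_hom: "module_hom wscale wscale gauge_coderivation"
  unfolding gauge_coderivation_def by (rule extend_hom[OF module_wscale])

text \<open>
  Testing the coderivation against a functional turns it into insertion of the operation.
\<close>

lemma gauge_coderivation_pairing:
  assumes "\<psi> \<in> sym_hom kL gauge_degrees t"
  shows "\<psi> (gauge_coderivation (wedge vs)) =
    tag_sum vs (insertion isl (\<lambda>ts. \<psi> (wedge (map untag ts))) gauge_letter)"
proof -
  interpret module_hom wscale t \<psi> by (rule sym_hom_hom[OF assms])
  show ?thesis
    by (simp add: gauge_coderivation_def extend_wedge[OF module_wscale] insertion_def[abs_def]
        tag_sum_hom[where H=\<psi>] unshuffle_sum_hom[where H=\<psi>] add)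
qed

lemma gauge_coderivation_dual:
  assumes "\<psi> \<in> sym_hom kL gauge_degrees t"
  shows "(\<lambda>w. \<psi> (gauge_coderivation w)) \<in> sym_hom kL gauge_degrees t"
proof -
  note \<psi> = sym_hom_tagged[OF assms module_X module_P]
  show ?thesis
    by (rule sym_homI_tagged[OF hom_compose[OF gauge_coderivation_hom sym_hom_hom[OF assms]]
          tag_linear_insertion[OF \<psi>(1) gauge_letter_tag_linear module_X module_P]
          graded_symmetric_insertion_tagged[OF \<psi>(1,2) gauge_letter_graded_symmetric module_X
              module_P]
          gauge_coderivation_pairing[OF assms] module_X module_P])
qed

text \<open>
  The dual statement is \<open>gauge_coderivation_dual\<close>: functionals on the symmetric coalgebra are
  stable under the transpose of the coderivation.
\<close>

lemma gauge_coderivation_null: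
  assumes "w \<in> sym_null kL gauge_degrees"
  shows "gauge_coderivation w \<in> sym_null kL gauge_degrees"
  by (rule sym_null_separated)
    (use gauge_coderivation_dual assms in \<open>auto simp: sym_hom_def\<close>)

text \<open>
  Separate insertions of an odd operation are equal to their own negatives, hence zero in
  characteristic \<open>0\<close>. In the remaining terms the operation is applied to a word that contains one
  of its own values, and these add up to its square.
\<close>

lemma insertion_square_zero:
  assumes \<psi>: "tag_linear kX kP ((*) :: 'k \<Rightarrow> 'k \<Rightarrow> 'k) f" "graded_symmetric isl f"
  shows "insertion isl (insertion isl f gauge_letter) gauge_letter ts = 0"
proof -
  have "separate_insertions isl f gauge_letter gauge_letter ts =
      - separate_insertions isl f gauge_letter gauge_letter ts"
    using separate_insertions_commute[OF \<psi>(2) isl_gauge_letter isl_gauge_letter]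
        by (simp add: signed_def)
  then have separate_insertions: "separate_insertions isl f gauge_letter gauge_letter ts = 0"
      by simp
  have "unshuffle_sum isl a (\<lambda>a b. f (gauge_letter (gauge_letter a # b) # e)) = 0" for a e
  proof -
    note h = head_as_tag_sum[OF \<psi>(1) module_X module_P]
    have "unshuffle_sum isl a (\<lambda>a b. f (gauge_letter (gauge_letter a # b) # e))
        = tag_sum (unshuffle_sum isl a (\<lambda>a b. untag (gauge_letter (gauge_letter a # b))) # map
            untag e) f"
      unfolding h(2) by (rule unshuffle_sum_hom[symmetric]) (use h(1) in \<open>simp add: module_hom_iff\<close>)
    then show ?thesis by (simp only: gauge_letter_square hom_at_zero[OF h(1)])
  qed
  then show ?thesis unfolding insertion_insertion by (simp add: separate_insertions)
qed

lemma gauge_coderivation_square: "gauge_coderivation (gauge_coderivation w) \<in> sym_null kL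
    gauge_degrees"
proof (rule sym_null_separated)
  fix \<psi> :: "_ \<Rightarrow> 'k" assume \<psi>: "\<psi> \<in> sym_hom kL gauge_degrees (*)"
  note \<psi>' = gauge_coderivation_dual[OF \<psi>] and tag = sym_hom_tagged[OF \<psi> module_X module_P]
  have sq: "\<psi> (gauge_coderivation (wedge (map untag ts)))
      = insertion isl (\<lambda>ts. \<psi> (wedge (map untag ts))) gauge_letter ts" for ts
    unfolding gauge_coderivation_pairing[OF \<psi>]
    by (rule tag_sum_untag[OF tag_linear_insertion[OF tag(1) gauge_letter_tag_linear module_X
        module_P]])
  have "\<psi> (gauge_coderivation (gauge_coderivation (wedge vs))) = 0" for vs
    using gauge_coderivation_pairing[OF \<psi>', of vs]
    unfolding sq insertion_square_zero[OF tag(1,2), THEN ext] by simp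
  then have "(\<lambda>w. \<psi> (gauge_coderivation (gauge_coderivation w))) = (\<lambda>w. 0)"
    using sym_hom_hom[OF gauge_coderivation_dual[OF \<psi>']]
    by (intro hom_eqI[of "(*)"] hom_zero module_wscale) (auto simp: module_hom_iff)
  then show "\<psi> (gauge_coderivation (gauge_coderivation w)) = 0" by meson
qed

lemma gauge_coderivation_is_coderivation:
  "is_coderivation_of kL gauge_degrees gauge_map gauge_coderivation"
  unfolding is_coderivation_of_def
proof (intro conjI allI impI ballI gauge_coderivation_hom gauge_coderivation_null)
  fix xs :: "('x \<times> 'p) list" and ds
  assume "homogeneous_list gauge_degrees xs ds"
  then obtain ts where ts: "xs = map untag ts" "list_all2 (\<lambda>t n. isl t = odd n) ts ds"
    using homogeneous_list_untag by metis
  show "gauge_coderivation (wedge xs) - coder_word gauge_map ds xs \<in> sym_null kL gauge_degrees"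
  proof (rule sym_null_separated)
    fix \<psi> :: "_ \<Rightarrow> 'k" assume \<psi>: "\<psi> \<in> sym_hom kL gauge_degrees (*)"
    interpret \<psi>: module_hom wscale "(*)" \<psi> by (rule sym_hom_hom[OF \<psi>])
    note tag = sym_hom_tagged[OF \<psi> module_X module_P]
    have "\<psi> (gauge_coderivation (wedge xs)) = insertion isl (\<lambda>ts. \<psi> (wedge (map untag ts)))
        gauge_letter ts"
      unfolding gauge_coderivation_pairing[OF \<psi>] ts(1)
      by (rule tag_sum_untag[OF
          tag_linear_insertion[OF tag(1) gauge_letter_tag_linear module_X module_P]])
    also have "\<dots> = \<psi> (coder_word gauge_map ds xs)"
      unfolding ts(1) coder_word_eq_unshuffle_sum[OF ts(2)] gauge_map_untag insertion_def
      by (simp add: unshuffle_sum_hom[where H=\<psi>] \<psi>.add)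
    finally show "\<psi> (gauge_coderivation (wedge xs) - coder_word gauge_map ds xs) = 0"
      by (simp add: \<psi>.diff)
  qed
qed

lemma gauge_map_degree: "has_degree gauge_degrees 1 gauge_map"
  unfolding has_degree_def
proof (intro allI impI)
  fix xs :: "('x \<times> 'p) list" and ds
  assume "homogeneous_list gauge_degrees xs ds"
  then obtain ts where ts: "xs = map untag ts" "0 \<in> set xs \<or> sum_list ds =
      - int (length (lefts ts))"
    using homogeneous_list_untag by metis
  show "gauge_map (wedge xs) \<in> gauge_degrees (sum_list ds + 1)"
  proof (cases "0 \<in> set xs")
    case True
    then obtain us vs where "xs = us @ 0 # vs" by (meson split_list)
    then have "gauge_map (wedge xs) = 0"
      using letter_linear_zero[OF sym_hom_letter_linear[OF gauge_map_sym_hom module_L]] by simp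
    then show ?thesis by (simp add: zero_in_gauge_degrees)
  next
    case False
    then have s: "sum_list ds = - int (length (lefts ts))" using ts by blast
    consider "lefts ts = []" | \<xi> where "lefts ts = [\<xi>]" | \<xi> \<eta> where "lefts ts = [\<xi>, \<eta>]"
        | "length (lefts ts) > 2"
      by (cases "lefts ts"; cases "tl (lefts ts)"; cases "tl (tl (lefts ts))") auto
    then show ?thesis
      unfolding ts(1) gauge_map_untag gauge_letter_def
    proof cases
      case 4
      then show "untag (gauge_value (lefts ts) (rights ts)) \<in> gauge_degrees (sum_list ds + 1)"
        by (simp add: untag_gauge_value_long zero_in_gauge_degrees)
    qed (auto simp: s zero_in_gauge_degrees desuspension_def gauge_grading_def simp del: pair_zero)
  qed
qed

lemma gauge_map_sh_Lie:
  "sh_Lie_structure kL gauge_grading (\<lambda>v. (0, d (fst v) [])) gauge_map"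
proof -
  have lin: "module_hom kL kL (\<lambda>v. (0 :: 'x, d (fst v) []))"
    using d_hom[of "[]"] module_X module_L
    by (auto simp: module_hom_iff gauge_scale_def module.scale_zero_right)
  have complex: "cochain_complex kL gauge_grading (\<lambda>v. (0 :: 'x, d (fst v) []))"
    unfolding cochain_complex_def
    using graded_space_gauge[OF module_X module_P] lin hom_at_zero[OF d_hom[of "[]"]]
    by (auto simp: module_hom_iff_linear gauge_grading_def simp del: pair_zero)
  have words: "gauge_map (wedge [untag t]) = (0, d (fst (untag t)) [])" for t
    using gauge_map_untag[of "[t]"] hom_at_zero[OF d_hom[of "[]"]]
    by (cases t) (simp_all add: gauge_letter_def)
  have "gauge_map (wedge [v]) = (0, d (fst v) [])" for v
    using words[of "Inl (fst v)"] words[of "Inr (snd v)"]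
      sym_hom_tagged(3)[OF gauge_map_sym_hom module_X module_P, of "[v]"]
          hom_at_zero[OF d_hom[of "[]"]]
    by simp
  then show ?thesis
    unfolding sh_Lie_structure_def
    using complex gauge_map_sym_hom gauge_map_degree gauge_coderivation_is_coderivation
      gauge_coderivation_square gauge_map_untag[of "[]"]
    by (auto simp: gauge_letter_def)
qed

end

section \<open>Gauge algebras satisfying the BBvD hypothesis\<close>

lemma restrict_scalars_hom:
  assumes "module_hom sM sN f" "module (restrict_scalars sA sM)" "module (restrict_scalars sA sN)"
  shows "module_hom (restrict_scalars sA sM) (restrict_scalars sA sN) f"
  using assms by (simp add: module_hom_iff) (simp add: restrict_scalars_def)

text \<open>
  The closure relation and the injectivity assumption are about \<open>A\<close>-linear and \<open>k\<close>-linear maps on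
  coalgebras over different rings; restricted to words, both involve the same sums. A word
  function annihilated by the extension is the restriction of a \<open>k\<close>-linear map, which is zero
  because it has the same image as the zero map.
\<close>

lemma gauge_words_BBvD:
  fixes sA :: "'k::field_char_0 \<Rightarrow> 'a::comm_ring_1 \<Rightarrow> 'a"
    and sX :: "'a \<Rightarrow> 'x::ab_group_add \<Rightarrow> 'x"
    and sP :: "'a \<Rightarrow> 'p::ab_group_add \<Rightarrow> 'p"
    and \<delta> :: "'x \<Rightarrow> ('p list \<Rightarrow>\<^sub>0 'a) \<Rightarrow> 'p"
    and C :: "'x \<Rightarrow> 'x \<Rightarrow> ('p list \<Rightarrow>\<^sub>0 'k) \<Rightarrow> 'x"
  defines "kX \<equiv> restrict_scalars sA sX"
    and "kP \<equiv> restrict_scalars sA sP"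
  assumes sP: "module sP"
    and \<delta>_hom: "\<And>\<xi>. \<delta> \<xi> \<in> sym_hom sP deg0 sP"
    and \<delta>_lin: "\<And>w. Vector_Spaces.linear kX kP (\<lambda>\<xi>. \<delta> \<xi> w)"
    and C_hom: "\<And>\<xi> \<eta>. C \<xi> \<eta> \<in> sym_hom kP deg0 kX"
    and C_left: "\<And>\<eta> w. Vector_Spaces.linear kX kX (\<lambda>\<xi>. C \<xi> \<eta> w)"
    and C_right: "\<And>\<xi> w. Vector_Spaces.linear kX kX (\<lambda>\<eta>. C \<xi> \<eta> w)"
    and BBvD: "\<And>\<xi> \<eta>. gbracket (\<delta> \<xi>) (\<delta> \<eta>) = hat_delta sP \<delta> (C \<xi> \<eta>)"
    and inj: "inj_on (hat_delta sP \<delta> :: (('p list \<Rightarrow>\<^sub>0 'k) \<Rightarrow> 'x) \<Rightarrow> _) (sym_hom kP deg0 kX)"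
  shows "gauge_words kX kP (\<lambda>\<xi> w. \<delta> \<xi> (wedge w)) (\<lambda>\<xi> \<eta> w. C \<xi> \<eta> (wedge w))"
proof (rule gauge_words.intro)
  have lin: "module_hom kX kP (\<lambda>\<xi>. \<delta> \<xi> w)" for w
    using \<delta>_lin by (simp add: module_hom_iff_linear)
  show kX: "module kX" and kP: "module kP" using lin by (simp_all add: module_hom_iff)
  show "module_hom kX kP (\<lambda>\<xi>. \<delta> \<xi> (wedge w))" for w by (rule lin)
  show "letter_linear kP kP (\<lambda>x. x) (\<lambda>w. \<delta> \<xi> (wedge w))" for \<xi>
    using letter_linearD[OF sym_hom_letter_linear[OF \<delta>_hom sP]] kP
    unfolding letter_linear_def kP_def by (blast intro: restrict_scalars_hom)
  show "graded_symmetric even_letters (\<lambda>w. \<delta> \<xi> (wedge w))" for \<xi>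
      by (rule sym_hom_deg0_graded_symmetric[OF \<delta>_hom])
  show "module_hom kX kX (\<lambda>\<xi>. C \<xi> \<eta> (wedge w))" "module_hom kX kX (\<lambda>\<xi>. C \<eta> \<xi> (wedge w))" for \<eta> w
    using C_left C_right by (simp_all add: module_hom_iff_linear)
  show "letter_linear kP kX (\<lambda>x. x) (\<lambda>w. C \<xi> \<eta> (wedge w))" for \<xi> \<eta>
    by (rule sym_hom_letter_linear[OF C_hom kP])
  show "graded_symmetric even_letters (\<lambda>w. C \<xi> \<eta> (wedge w))" for \<xi> \<eta>
      by (rule sym_hom_deg0_graded_symmetric[OF C_hom])
  show "commutator (\<lambda>w. \<delta> \<xi> (wedge w)) (\<lambda>w. \<delta> \<eta> (wedge w)) w
      = hat_words (\<lambda>\<xi> w. \<delta> \<xi> (wedge w)) (\<lambda>w. C \<xi> \<eta> (wedge w)) w" for \<xi> \<eta> w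
    using BBvD[of \<xi> \<eta>, THEN fun_cong, of "wedge w"]
    by (simp add: gbracket_def commutator_def odot_wedge[OF sym_hom_hom[OF \<delta>_hom]]
        hat_delta_wedge[OF sP])
  show "\<pi> w = 0" if \<pi>: "letter_linear kP kX (\<lambda>x. x) \<pi>" "graded_symmetric even_letters \<pi>"
      and zero: "\<And>w. hat_words (\<lambda>\<xi> w. \<delta> \<xi> (wedge w)) \<pi> w = 0" for \<pi> w
  proof -
    have 1: "extend kX \<pi> \<in> sym_hom kP deg0 kX" by (rule extend_sym_hom_deg0[OF kX \<pi>])
    have "letter_linear kP kX (\<lambda>x. x) (\<lambda>w. 0)" "graded_symmetric even_letters (\<lambda>w. 0 :: 'x)"
      using hom_zero[OF kP kX] by (auto simp: letter_linear_def graded_symmetric_def)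
    then have 2: "extend kX (\<lambda>w. 0) \<in> sym_hom kP deg0 kX" by (rule extend_sym_hom_deg0[OF kX])
    have "hat_delta sP \<delta> (extend kX \<pi>) = hat_delta sP \<delta> (extend kX (\<lambda>w. 0 :: 'x))"
    proof (rule hom_eqI[of sP])
      show "module_hom wscale sP (hat_delta sP \<delta> \<rho>)" for \<rho> :: "('p list \<Rightarrow>\<^sub>0 'k) \<Rightarrow> 'x"
        unfolding hat_delta_def by (rule extend_hom[OF sP])
      then show "module_hom wscale sP (hat_delta sP \<delta> \<rho>)" for \<rho> :: "('p list \<Rightarrow>\<^sub>0 'k) \<Rightarrow> 'x" .
      show "hat_delta sP \<delta> (extend kX \<pi>) (wedge xs)
          = hat_delta sP \<delta> (extend kX (\<lambda>w. 0)) (wedge xs)" for xs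
        using zero[of xs] hom_at_zero[OF lin]
        by (simp add: hat_delta_wedge[OF sP] extend_wedge[OF kX] hat_words_def)
    qed
    then have "extend kX \<pi> = extend kX (\<lambda>w. 0)" by (rule inj_onD[OF inj _ 1 2])
    then have "extend kX \<pi> (wedge w) = extend kX (\<lambda>w. 0) (wedge w)" by (rule fun_cong)
    then show "\<pi> w = 0" by (simp add: extend_wedge[OF kX])
  qed
qed

theorem theorem2:
  fixes sA :: "'k::field_char_0 \<Rightarrow> 'a::comm_ring_1 \<Rightarrow> 'a"
    and sX :: "'a \<Rightarrow> 'x::ab_group_add \<Rightarrow> 'x"
    and sP :: "'a \<Rightarrow> 'p::ab_group_add \<Rightarrow> 'p"
    and \<delta> :: "'x \<Rightarrow> ('p list \<Rightarrow>\<^sub>0 'a) \<Rightarrow> 'p"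
    and C :: "'x \<Rightarrow> 'x \<Rightarrow> ('p list \<Rightarrow>\<^sub>0 'k) \<Rightarrow> 'x"
  defines "kX \<equiv> restrict_scalars sA sX"
    and "kP \<equiv> restrict_scalars sA sP"
  defines "kL \<equiv> gauge_scale kX kP"
  assumes "comm_algebra sA" and "module sX" and "module sP"
    and "\<And>\<xi>. \<delta> \<xi> \<in> sym_hom sP deg0 sP"
    and "\<And>w. Vector_Spaces.linear kX kP (\<lambda>\<xi>. \<delta> \<xi> w)"
    and "\<And>\<xi> \<eta>. C \<xi> \<eta> \<in> sym_hom kP deg0 kX"
    and "\<And>\<eta> w. Vector_Spaces.linear kX kX (\<lambda>\<xi>. C \<xi> \<eta> w)"
    and "\<And>\<xi> w. Vector_Spaces.linear kX kX (\<lambda>\<eta>. C \<xi> \<eta> w)"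
    and BBvD: "\<And>\<xi> \<eta>. gbracket (\<delta> \<xi>) (\<delta> \<eta>) = hat_delta sP \<delta> (C \<xi> \<eta>)"
    and "inj_on (hat_delta sP \<delta> :: (('p list \<Rightarrow>\<^sub>0 'k) \<Rightarrow> 'x) \<Rightarrow> _) (sym_hom kP deg0 kX)"
  shows "(\<exists>!D. D \<in> sym_hom kL (desuspension gauge_grading) kL \<and> is_gauge_map \<delta> C D) \<and>
    (\<forall>D. D \<in> sym_hom kL (desuspension gauge_grading) kL \<and> is_gauge_map \<delta> C D \<longrightarrow>
       sh_Lie_structure kL gauge_grading (gauge_diff \<delta>) D)"
proof -
  interpret gauge_words kX kP "\<lambda>\<xi> w. \<delta> \<xi> (wedge w)" "\<lambda>\<xi> \<eta> w. C \<xi> \<eta> (wedge w)"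
    unfolding kX_def kP_def by (rule gauge_words_BBvD[OF assms(6-13)[unfolded kX_def kP_def]])
  have map_untag: "map untag (map Inl \<xi>s @ map Inr \<phi>s) = map (\<lambda>\<xi>. (\<xi>, 0)) \<xi>s @ map (Pair 0) \<phi>s"
    for \<xi>s :: "'x list" and \<phi>s :: "'p list" by simp
  have iff: "is_gauge_map \<delta> C D \<longleftrightarrow>
      (\<forall>\<xi>s \<phi>s. D (wedge (map untag (map Inl \<xi>s @ map Inr \<phi>s))) = untag (gauge_value \<xi>s \<phi>s))" for D
  proof
    assume D: "is_gauge_map \<delta> C D"
    show "\<forall>\<xi>s \<phi>s. D (wedge (map untag (map Inl \<xi>s @ map Inr \<phi>s))) = untag (gauge_value \<xi>s \<phi>s)"
    proof (intro allI)
      fix \<xi>s :: "'x list" and \<phi>s :: "'p list"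
      consider "\<xi>s = []" | \<xi> where "\<xi>s = [\<xi>]" | \<xi> \<eta> where "\<xi>s = [\<xi>, \<eta>]" | "length \<xi>s > 2"
        by (cases \<xi>s; cases "tl \<xi>s"; cases "tl (tl \<xi>s)") auto
      then show "D (wedge (map untag (map Inl \<xi>s @ map Inr \<phi>s))) = untag (gauge_value \<xi>s \<phi>s)"
        unfolding map_untag
      proof cases
        case 1
        then show "D (wedge (map (\<lambda>\<xi>. (\<xi>, 0)) \<xi>s @ map (Pair 0) \<phi>s)) = untag (gauge_value \<xi>s \<phi>s)"
          using D unfolding is_gauge_map_def by auto
      next
        case (2 \<xi>)
        then show "D (wedge (map (\<lambda>\<xi>. (\<xi>, 0)) \<xi>s @ map (Pair 0) \<phi>s)) = untag (gauge_value \<xi>s \<phi>s)"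
          using D unfolding is_gauge_map_def gauge_diff_def by (cases "\<phi>s = []") auto
      next
        case (3 \<xi> \<eta>)
        then show "D (wedge (map (\<lambda>\<xi>. (\<xi>, 0)) \<xi>s @ map (Pair 0) \<phi>s)) = untag (gauge_value \<xi>s \<phi>s)"
          using D unfolding is_gauge_map_def by auto
      next
        case 4
        then show "D (wedge (map (\<lambda>\<xi>. (\<xi>, 0)) \<xi>s @ map (Pair 0) \<phi>s)) = untag (gauge_value \<xi>s \<phi>s)"
          using D unfolding is_gauge_map_def by (auto simp: untag_gauge_value_long)
      qed
    qed
  next
    assume "\<forall>\<xi>s \<phi>s. D (wedge (map untag (map Inl \<xi>s @ map Inr \<phi>s))) = untag (gauge_value \<xi>s \<phi>s)"
    then have D: "D (wedge (map (\<lambda>\<xi>. (\<xi>, 0)) \<xi>s @ map (Pair 0) \<phi>s)) = untag (gauge_value \<xi>s \<phi>s)"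
      for \<xi>s \<phi>s unfolding map_untag by blast
    show "is_gauge_map \<delta> C D"
      using D[of "[_]" "[]"] D[of "[_]"] D[of "[_, _]"] D[of "[]"]
      unfolding is_gauge_map_def gauge_diff_def
      by (auto simp: D untag_gauge_value_long)
  qed
  have exists: "gauge_map \<in> sym_hom kL gauge_degrees kL \<and> is_gauge_map \<delta> C gauge_map"
    unfolding iff gauge_map_untag kL_def by (simp add: gauge_map_sym_hom gauge_letter_def)
  have unique: "D = gauge_map" if "D \<in> sym_hom kL gauge_degrees kL \<and> is_gauge_map \<delta> C D" for D
    using that unfolding iff kL_def by (intro gauge_map_unique) blast+
  have "sh_Lie_structure kL gauge_grading (gauge_diff \<delta>) gauge_map"
    using gauge_map_sh_Lie unfolding gauge_diff_def[abs_def] kL_def .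
  with exists unique show ?thesis by blast
qed

end
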